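(* Let $\alpha$ be the graph of a given convex polyhedron in Euclidean $3$-space, and let $\gamma$ be another given graph. Then the number of graphs $\beta$ that are inscribed into $\alpha$ and circumscribed around $\gamma$ is at most $4$.
   Context: The graph (1-skeleton) $\alpha$ of a convex polyhedron consists of its vertices and edges, and the faces of $\alpha$ are the (convex polygonal) faces of the polyhedron. A graph $\beta$ is inscribed into $\alpha$ (equivalently, $\alpha$ is circumscribed around $\beta$) if it is obtained as follows: on each edge of $\alpha$ choose exactly one point, different from the endpoints of that edge; these points are the vertices of $\beta$. On each face of $\alpha$, connect the chosen points lying on the edges of that face to form a convex polygon (consecutive edges of the face give consecutive vertices of the polygon). The edges of $\beta$ are the sides of all these polygons, one polygon for each face of $\alpha$. For such a $\beta$, a graph $\gamma$ is inscribed into $\beta$ (equivalently, $\beta$ is circumscribed around $\gamma$) if the vertices of $\gamma$ are obtained by choosing exactly one point on each edge of $\beta$, different from the endpoints of that edge, and, on each face of $\alpha$, the vertices of $\gamma$ lying on that face are connected by edges of $\gamma$ to form a convex polygon, whose vertices thus lie one on each side of the polygon of $\beta$ on that face. The remaining edges of $\gamma$ (those joining vertices of $\gamma$ on different faces of $\alpha$) play no role and are left unspecified; they impose no condition on $\beta$. Here $\alpha$ and $\gamma$ are fixed, and one counts the graphs $\beta$ that are inscribed into $\alpha$ and such that $\gamma$ is inscribed into $\beta$ in this sense. *)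

theory Defs
  imports "HOL-Analysis.Analysis"
begin

(* A graph drawn with straight edges: every edge is stored as the closed segment
   between its endpoints, in agreement with the edges of a polytope given by edge_of. *)
record 'a geom_graph =
  vertices :: "'a set"
  edges :: "'a set set"

definition is_graph :: "('a::euclidean_space) geom_graph \<Rightarrow> bool" where
  "is_graph G \<longleftrightarrow>
     edges G \<subseteq> {closed_segment p q | p q. p \<in> vertices G \<and> q \<in> vertices G \<and> p \<noteq> q}"

definition skeleton :: "('a::euclidean_space) set \<Rightarrow> 'a geom_graph" where
  "skeleton P = \<lparr> vertices = {v. v extreme_point_of P}, edges = {e. e edge_of P} \<rparr>"

definition polyhedron_faces :: "('a::euclidean_space) set \<Rightarrow> 'a set set" where
  "polyhedron_faces P = {F. F facet_of P}"

definition edges_on :: "('a::euclidean_space) geom_graph \<Rightarrow> 'a set \<Rightarrow> 'a set set" where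
  "edges_on G F = {e \<in> edges G. e \<subseteq> F}"

(* S is the vertex set and E the set of sides of a (nondegenerate) convex polygon. *)
definition forms_convex_polygon :: "('a::euclidean_space) set \<Rightarrow> 'a set set \<Rightarrow> bool" where
  "forms_convex_polygon S E \<longleftrightarrow>
     finite S \<and> aff_dim S = 2 \<and> (\<forall>p\<in>S. p extreme_point_of (convex hull S)) \<and>
     E = {e. e edge_of (convex hull S)}"

(* One point on each edge, different from the endpoints: the relative interior of a
   nondegenerate segment is the segment without its endpoints. *)
definition chooses_inner_points ::
    "('a::euclidean_space) geom_graph \<Rightarrow> ('a set \<Rightarrow> 'a) \<Rightarrow> bool" where
  "chooses_inner_points G x \<longleftrightarrow> (\<forall>e \<in> edges G. x e \<in> rel_interior e)"

(* The segments joining the points x chosen on consecutive edges of the face F of G;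
   distinct edges of a face are consecutive iff they meet (in a common endpoint). *)
definition joined_points ::
    "('a::euclidean_space) geom_graph \<Rightarrow> 'a set \<Rightarrow> ('a set \<Rightarrow> 'a) \<Rightarrow> 'a set set" where
  "joined_points G F x =
     {closed_segment (x e) (x e') | e e'.
        e \<in> edges_on G F \<and> e' \<in> edges_on G F \<and> e \<noteq> e' \<and> e \<inter> e' \<noteq> {}}"

(* \<F> is the set of faces of \<alpha>.  The convexity demanded in the last conjunct is
   automatic when \<alpha> is the skeleton of a convex polyhedron. *)
definition inscribed_into ::
    "('a::euclidean_space) set set \<Rightarrow> 'a geom_graph \<Rightarrow> 'a geom_graph \<Rightarrow> bool" where
  "inscribed_into \<F> \<beta> \<alpha> \<longleftrightarrow>
     (\<exists>x. chooses_inner_points \<alpha> x \<and>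
          vertices \<beta> = x ` edges \<alpha> \<and>
          edges \<beta> = (\<Union>F\<in>\<F>. joined_points \<alpha> F x) \<and>
          (\<forall>F\<in>\<F>. forms_convex_polygon (x ` edges_on \<alpha> F) (joined_points \<alpha> F x)))"

(* \<F> is still the set of faces of \<alpha>.  Only the edges of \<gamma> inside a face are
   prescribed; those joining points of different faces are left free.  The
   correspondence y between edges of \<beta> and vertices of \<gamma> is not part of the data. *)
definition inscribed_on_faces ::
    "('a::euclidean_space) set set \<Rightarrow> 'a geom_graph \<Rightarrow> 'a geom_graph \<Rightarrow> bool" where
  "inscribed_on_faces \<F> \<gamma> \<beta> \<longleftrightarrow>
     (\<exists>y. chooses_inner_points \<beta> y \<and> vertices \<gamma> = y ` edges \<beta>) \<and>
     (\<forall>F\<in>\<F>. forms_convex_polygon (vertices \<gamma> \<inter> F) (edges_on \<gamma> F))"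

end

theory Submission
  imports Defs
begin

text \<open>Let \<open>x\<close> be the choice of points on the edges of \<open>P\<close> that defines a graph inscribed into the skeleton and
circumscribed around \<open>\<gamma>\<close>, and let \<open>x'\<close> be another such choice. Everything rests on an observation about a single corner
(\<open>corner_rigid\<close>): if \<open>e\<close> and \<open>e'\<close> are edges of a facet that meet at \<open>v\<close>, then either \<open>x'\<close> agrees with \<open>x\<close> on both, or one of
the two points is nearer to \<open>v\<close> for \<open>x'\<close> than for \<open>x\<close>, and the other one is farther from \<open>v\<close>. Otherwise a vertex of \<open>\<gamma>\<close> on the side joining
the nearer pair of points would lie strictly between \<open>v\<close> and the line through the farther pair, where the other polygon, and hence \<open>\<gamma>\<close>,
has no points.

It follows that agreement on one edge spreads to all edges, because all edges are linked through corners
(\<open>agree_everywhere\<close>). If \<open>x\<close> and \<open>x'\<close> differ, their points move towards a vertex and away from it alternately around that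
vertex. This is impossible at a vertex of degree three, so in the presence of such a vertex there is at most one graph.

A polyhedron without vertices of degree three has a triangular facet (\<open>trivalent_vertex_or_triangle\<close>). This needs only the
half \<open>E < V + F\<close> of the Euler formula, which is obtained by sweeping the polyhedron with a generic linear functional and
looking at the vertex figures (\<open>euler_inequality\<close>).

In a triangular facet three points of \<open>\<gamma>\<close> are given, and one has to count the inscribed triangles with one of
these points on each side. By the corner principle any two solutions differ by moving all three vertices forward or all three
backward, so the solutions are linearly ordered. Compared with the first solution, every other one either has the same points of
\<open>\<gamma>\<close> on its sides, or has them cyclically shifted by one place (\<open>fits_shift\<close>). For each of these two correspondences the
position of a vertex is a root of a fixed nonzero quadratic polynomial (\<open>card_fits_le_2\<close>). Hence there are at most four solutions.\<close>

section \<open>Vertex figures of polytopes\<close>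

definition dim_faces :: "int \<Rightarrow> 'a::euclidean_space set \<Rightarrow> 'a set set" where
  "dim_faces k P = {F. F face_of P \<and> aff_dim F = k}"

text \<open>The hyperplane \<open>a \<bullet> x = b\<close> separates the vertex \<open>v\<close> from all the other vertices of \<open>P\<close>, so that
the slice of \<open>P\<close> by it is a vertex figure of \<open>P\<close> at \<open>v\<close>.\<close>

definition cuts_off :: "'a::euclidean_space set \<Rightarrow> 'a \<Rightarrow> 'a \<Rightarrow> real \<Rightarrow> bool" where
  "cuts_off P v a b \<longleftrightarrow> v extreme_point_of P \<and> a \<bullet> v < b \<and>
     (\<forall>w. w extreme_point_of P \<and> w \<noteq> v \<longrightarrow> b < a \<bullet> w)"

abbreviation slice :: "'a::euclidean_space set \<Rightarrow> 'a \<Rightarrow> real \<Rightarrow> 'a set" where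
  "slice P a b \<equiv> P \<inter> {z. a \<bullet> z = b}"

lemma finite_extreme_points:
  fixes P :: "'a::euclidean_space set"
  assumes "polytope P" shows "finite {v. v extreme_point_of P}"
  using assms by (simp add: finite_polyhedron_extreme_points polytope_imp_polyhedron)

lemma polytope_eq_hull:
  fixes P :: "'a::euclidean_space set"
  assumes "polytope P" shows "P = convex hull {v. v extreme_point_of P}"
  using Krein_Milman_Minkowski polytope_imp_compact polytope_imp_convex assms by blast

lemma finite_dim_faces:
  assumes "polytope P" shows "finite (dim_faces k P)"
  using finite_polytope_faces[OF assms] by (auto simp: dim_faces_def elim: finite_subset[rotated])

text \<open>Faces of a polytope are exposed, so some functional has its maximum over \<open>P\<close> only at \<open>v\<close>; as there
are finitely many vertices, a threshold fits between the values at \<open>v\<close> and at the others.\<close>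

lemma exists_cuts_off:
  fixes P :: "'a::euclidean_space set"
  assumes "polytope P" "v extreme_point_of P"
  shows "\<exists>a b. cuts_off P v a b"
proof -
  have "{v} face_of P" using assms(2) by (simp add: face_of_singleton)
  then have "{v} exposed_face_of P"
    using assms(1) exposed_face_of_polyhedron polytope_imp_polyhedron by blast
  then obtain a b where ab: "P \<subseteq> {x. a \<bullet> x \<le> b}" "{v} = P \<inter> {x. a \<bullet> x = b}"
    by (auto simp: exposed_face_of_def)
  define W where "W = {w. w extreme_point_of P} - {v}"
  have fW: "finite W" using finite_extreme_points[OF assms(1)] by (simp add: W_def)
  have lt: "a \<bullet> w < b" if "w \<in> W" for w
  proof -
    have "w \<in> P" "w \<noteq> v" using that by (auto simp: W_def extreme_point_of_def)
    then have "a \<bullet> w \<le> b" "a \<bullet> w \<noteq> b" using ab by blast+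
    then show ?thesis by simp
  qed
  define m where "m = Max (insert (b - 1) ((\<bullet>) a ` W))"
  have "m < b" using fW lt by (simp add: m_def)
  have le: "a \<bullet> w \<le> m" if "w \<in> W" for w using that fW by (auto simp: m_def)
  have "a \<bullet> v = b" using ab by blast
  \<comment> \<open>the exposing functional is largest at v, whereas a cut has v on the low side: hence the signs\<close>
  have "cuts_off P v (- a) (- ((m + b) / 2))"
    unfolding cuts_off_def using assms(2) \<open>m < b\<close> le \<open>a \<bullet> v = b\<close>
    by (fastforce simp: W_def)
  then show ?thesis by blast
qed

lemma cuts_off_face:
  assumes "cuts_off P v a b" "F face_of P" "v \<in> F"
  shows "cuts_off F v a b"
  using assms extreme_point_of_face unfolding cuts_off_def by blast

lemma face_misses_slice:
  fixes P :: "'a::euclidean_space set"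
  assumes "polytope P" "cuts_off P v a b" "F face_of P" "v \<notin> F"
  shows "slice F a b = {}"
proof -
  have pF: "polytope F" using assms face_of_polytope_polytope by blast
  have "{w. w extreme_point_of F} \<subseteq> {x. a \<bullet> x > b}"
    using assms by (auto simp: cuts_off_def extreme_point_of_face[OF assms(3)])
  then have "convex hull {w. w extreme_point_of F} \<subseteq> {x. a \<bullet> x > b}"
    by (simp add: convex_halfspace_gt hull_minimal)
  then show ?thesis using polytope_eq_hull[OF pF] by auto
qed

text \<open>Vertices strictly on both sides of the hyperplane force relative interior points on both sides,
since the relative interior is dense in \<open>P\<close>; being connected, it meets the hyperplane.\<close>

lemma rel_interior_meets_slice:
  fixes P :: "'a::euclidean_space set"
  assumes "polytope P" "cuts_off P v a b" "P \<noteq> {v}"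
  shows "slice (rel_interior P) a b \<noteq> {}"
proof -
  have cP: "convex P" using assms(1) polytope_imp_convex by blast
  have ev: "v extreme_point_of P" using assms(2) by (simp add: cuts_off_def)
  obtain w where w: "w extreme_point_of P" "w \<noteq> v"
  proof (rule ccontr)
    assume "\<not> thesis"
    then have "{w. w extreme_point_of P} = {v}" using that ev by blast
    then show False using polytope_eq_hull[OF assms(1)] assms(3) by simp
  qed
  have cl: "x \<in> closure (rel_interior P)" if "x extreme_point_of P" for x
    using that cP convex_closure_rel_interior closure_subset by (auto simp: extreme_point_of_def)
  have o1: "open {x. a \<bullet> x < b}" and o2: "open {x. a \<bullet> x > b}"
    by (simp_all add: open_halfspace_lt open_halfspace_gt)
  have "rel_interior P \<inter> {x. a \<bullet> x < b} \<noteq> {}"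
    using open_Int_closure_eq_empty[OF o1] cl[OF ev] assms(2) unfolding cuts_off_def by blast
  then obtain z1 where z1: "z1 \<in> rel_interior P" "a \<bullet> z1 < b" by blast
  have "b < a \<bullet> w" using w assms(2) by (simp add: cuts_off_def)
  then have "rel_interior P \<inter> {x. a \<bullet> x > b} \<noteq> {}"
    using open_Int_closure_eq_empty[OF o2] cl[OF w(1)] by blast
  then obtain z2 where z2: "z2 \<in> rel_interior P" "a \<bullet> z2 > b" by blast
  have "connected (rel_interior P)" using cP convex_connected convex_rel_interior by blast
  then obtain z where "z \<in> rel_interior P" "a \<bullet> z = b"
    using connected_ivt_hyperplane[of "rel_interior P" z1 z2 a b] z1 z2 by (metis less_eq_real_def)
  then show ?thesis by blast
qed

lemma rel_interior_slice:
  fixes P :: "'a::euclidean_space set"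
  assumes "polytope P" "cuts_off P v a b" "P \<noteq> {v}"
  shows "rel_interior (slice P a b) = slice (rel_interior P) a b"
  using rel_interior_meets_slice[OF assms] polytope_imp_convex[OF assms(1)]
  by (intro convex_affine_rel_interior_Int) (auto simp: affine_hyperplane)

text \<open>The relative interior of the slice is relatively open in the section of the affine hull by the
hyperplane, hence spans that section, whose dimension is one less.\<close>

lemma aff_dim_slice:
  fixes P :: "'a::euclidean_space set"
  assumes "polytope P" "cuts_off P v a b" "P \<noteq> {v}"
  shows "aff_dim (slice P a b) = aff_dim P - 1"
proof -
  let ?H = "{z. a \<bullet> z = b}" let ?A = "affine hull P \<inter> ?H"
  have affA: "affine ?A" by (intro affine_Int affine_affine_hull affine_hyperplane)
  have ne: "slice (rel_interior P) a b \<noteq> {}" by (rule rel_interior_meets_slice[OF assms])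
  have "openin (top_of_set ?A) (rel_interior P \<inter> ?H)"
  proof -
    obtain T where "open T" "rel_interior P = affine hull P \<inter> T"
      using openin_rel_interior[of P] by (auto simp: openin_open)
    then have "rel_interior P \<inter> ?H = ?A \<inter> T" by blast
    with \<open>open T\<close> show ?thesis by (auto simp: openin_open)
  qed
  then have "affine hull (rel_interior P \<inter> ?H) = ?A"
    using affine_hull_openin[of ?A "rel_interior P \<inter> ?H"] ne affA by (metis affine_hull_eq)
  moreover have "rel_interior P \<inter> ?H \<subseteq> slice P a b"
    using rel_interior_subset by blast
  moreover have "slice P a b \<subseteq> ?A" using hull_subset[of P affine] by blast
  ultimately have "affine hull (slice P a b) = ?A"
    using hull_mono[of "rel_interior P \<inter> ?H" "slice P a b" affine]
      hull_minimal[of "slice P a b" ?A affine] affA by (intro subset_antisym) simp_all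
  then have "aff_dim (slice P a b) = aff_dim ?A" by (metis aff_dim_affine_hull)
  moreover have "v \<in> affine hull P" "v \<notin> ?H"
    using assms(2) hull_inc[of v P affine] by (auto simp: cuts_off_def extreme_point_of_def)
  moreover have "?A \<noteq> {}" using ne rel_interior_subset hull_subset[of P affine] by blast
  ultimately show ?thesis
    using aff_dim_affine_Int_hyperplane[of "affine hull P" a b] by (auto simp: aff_dim_affine_hull)
qed

lemma polytope_slice:
  fixes P :: "'a::euclidean_space set"
  assumes "polytope P" shows "polytope (slice P a b)"
  using assms polytope_Int_polyhedron polyhedron_hyperplane by blast

text \<open>The smallest face containing \<open>z\<close> works: if \<open>z\<close> lay on its relative boundary, then \<open>z\<close> would be
on a facet of it, which is a smaller face.\<close>

lemma face_through_rel_interior: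
  fixes P :: "'a::euclidean_space set"
  assumes "polytope P" "z \<in> P"
  obtains F where "F face_of P" "z \<in> rel_interior F"
proof -
  let ?S = "{F. F face_of P \<and> z \<in> F}"
  define F where "F = \<Inter>?S"
  have "P \<in> ?S" using assms by (simp add: face_of_refl polytope_imp_convex)
  then have F: "F face_of P" unfolding F_def by (intro face_of_Inter) auto
  have zF: "z \<in> F" by (auto simp: F_def)
  have "polyhedron F" using F assms(1) face_of_polytope_polytope polytope_imp_polyhedron by blast
  moreover have "z \<notin> F'" if "F' facet_of F" for F'
  proof
    assume "z \<in> F'"
    then have "F \<subseteq> F'" using that F face_of_trans facet_of_imp_face_of unfolding F_def by blast
    then have "F = F'" using facet_of_imp_subset[OF that] by blast
    then show False using that facet_of_irrefl by blast
  qed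
  ultimately have "z \<in> rel_interior F" using zF by (simp add: rel_interior_of_polyhedron)
  with F show thesis by (rule that)
qed

lemma slice_of_face:
  fixes P :: "'a::euclidean_space set"
  assumes "polytope P" "cuts_off P v a b" "F face_of P" "v \<in> F" "F \<noteq> {v}"
  shows "slice F a b face_of slice P a b" "slice F a b \<noteq> {}"
    "aff_dim (slice F a b) = aff_dim F - 1"
    "rel_interior (slice F a b) = slice (rel_interior F) a b"
proof -
  have F: "polytope F" "cuts_off F v a b"
    using assms face_of_polytope_polytope cuts_off_face by blast+
  show "slice F a b face_of slice P a b"
    using assms(3) by (rule face_of_slice) (simp add: convex_hyperplane)
  show "slice F a b \<noteq> {}"
    using rel_interior_meets_slice[OF F assms(5)] rel_interior_subset by blast
  show "aff_dim (slice F a b) = aff_dim F - 1" by (rule aff_dim_slice[OF F assms(5)])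
  show "rel_interior (slice F a b) = slice (rel_interior F) a b"
    by (rule rel_interior_slice[OF F assms(5)])
qed

text \<open>Every nonempty face of the vertex figure comes from the face of \<open>P\<close> that has one of its relative
interior points \<open>z\<close> in its relative interior. That face contains \<open>v\<close>, because a face without \<open>v\<close> is spanned
by vertices beyond the hyperplane.\<close>

lemma face_of_slice_lift:
  fixes P :: "'a::euclidean_space set"
  assumes "polytope P" "cuts_off P v a b" "G face_of slice P a b" "G \<noteq> {}"
  obtains F where "F face_of P" "v \<in> F" "F \<noteq> {v}" "slice F a b = G"
proof -
  have "convex G" using assms(3) by (rule face_of_imp_convex)
  then obtain z where z: "z \<in> rel_interior G" using assms(4) rel_interior_eq_empty by blast
  then have zP: "z \<in> P" "a \<bullet> z = b"
    using rel_interior_subset face_of_imp_subset[OF assms(3)] by blast+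
  obtain F where F: "F face_of P" "z \<in> rel_interior F"
    using face_through_rel_interior[OF assms(1) zP(1)] .
  have zF: "z \<in> F" using F(2) rel_interior_subset by blast
  have vF: "v \<in> F" using face_misses_slice[OF assms(1,2) F(1)] zF zP(2) by blast
  have ne: "F \<noteq> {v}" using zF zP(2) assms(2) by (auto simp: cuts_off_def)
  note S = slice_of_face[OF assms(1,2) F(1) vF ne]
  have "z \<in> rel_interior (slice F a b)" using S(4) F(2) zP by simp
  then have "slice F a b = G" using face_of_eq[OF S(1) assms(3)] z by blast
  with F(1) vF ne show thesis by (rule that)
qed

lemma slice_mono_iff:
  fixes P :: "'a::euclidean_space set"
  assumes "polytope P" "cuts_off P v a b" "F face_of P" "v \<in> F" "F \<noteq> {v}" "F' face_of P"
  shows "slice F a b \<subseteq> slice F' a b \<longleftrightarrow> F \<subseteq> F'"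
proof
  assume sub: "slice F a b \<subseteq> slice F' a b"
  have "polytope F" "cuts_off F v a b"
    using assms face_of_polytope_polytope cuts_off_face by blast+
  then obtain z where z: "z \<in> rel_interior F" "a \<bullet> z = b"
    using rel_interior_meets_slice[of F v a b] assms(5) by blast
  then have "z \<in> F'" using sub rel_interior_subset by blast
  then show "F \<subseteq> F'"
    using subset_of_face_of[OF assms(6)] face_of_imp_subset[OF assms(3)] z by blast
qed blast

text \<open>Slicing is an isomorphism from the faces through \<open>v\<close> other than \<open>{v}\<close> onto the nonempty faces of
the vertex figure, lowering dimensions by one. The parameter \<open>e\<close> restricts it to the faces above a given
face; \<open>e = {v}\<close> gives all of them.\<close>

lemma bij_betw_slice:
  fixes P :: "'a::euclidean_space set"
  assumes "polytope P" "cuts_off P v a b" "k \<ge> 0" "e face_of P" "v \<in> e"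
  shows "bij_betw (\<lambda>F. slice F a b) {F \<in> dim_faces (k + 1) P. e \<subseteq> F}
           {G \<in> dim_faces k (slice P a b). slice e a b \<subseteq> G}"
proof (rule bij_betwI')
  have ne: "F \<noteq> {v}" if "F \<in> dim_faces (k + 1) P" for F
    using that assms(3) by (auto simp: dim_faces_def)
  have ev: "v extreme_point_of P" using assms(2) by (simp add: cuts_off_def)
  {
    fix F F' assume "F \<in> {F \<in> dim_faces (k + 1) P. e \<subseteq> F}" "F' \<in> {F \<in> dim_faces (k + 1) P. e \<subseteq> F}"
    then show "slice F a b = slice F' a b \<longleftrightarrow> F = F'"
      using slice_mono_iff[OF assms(1,2), of F F'] slice_mono_iff[OF assms(1,2), of F' F] ne assms(5)
      unfolding dim_faces_def by blast
  next
    fix F assume "F \<in> {F \<in> dim_faces (k + 1) P. e \<subseteq> F}"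
    then show "slice F a b \<in> {G \<in> dim_faces k (slice P a b). slice e a b \<subseteq> G}"
      using slice_of_face[OF assms(1,2), of F] ne assms(5) by (auto simp: dim_faces_def)
  next
    fix G assume G: "G \<in> {G \<in> dim_faces k (slice P a b). slice e a b \<subseteq> G}"
    then have "G \<noteq> {}" using assms(3) by (auto simp: dim_faces_def)
    then obtain F where F: "F face_of P" "v \<in> F" "F \<noteq> {v}" "slice F a b = G"
      using face_of_slice_lift[OF assms(1,2)] G by (auto simp: dim_faces_def)
    have "aff_dim F = k + 1"
      using slice_of_face(3)[OF assms(1,2) F(1-3)] F(4) G by (simp add: dim_faces_def)
    moreover have "e \<subseteq> F"
    proof (cases "e = {v}")
      case False
      then show ?thesis using slice_mono_iff[OF assms(1,2,4,5) _ F(1)] F(4) G by simp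
    qed (use F(2) in simp)
    ultimately show "\<exists>F \<in> {F \<in> dim_faces (k + 1) P. e \<subseteq> F}. G = slice F a b"
      using F by (auto simp: dim_faces_def)
  }
qed

lemma dim_faces_0: "dim_faces 0 P = (\<lambda>v. {v}) ` {v. v extreme_point_of P}"
  unfolding dim_faces_def using face_of_singleton by (auto simp: aff_dim_eq_0 image_iff)

lemma one_dim_polytope_segment:
  fixes e :: "'a::euclidean_space set"
  assumes "polytope e" "aff_dim e = 1"
  obtains p q where "e = closed_segment p q" "p \<noteq> q"
proof -
  have "collinear e" using assms(2) by (simp add: collinear_aff_dim)
  moreover have "e \<noteq> {}" using assms(2) by auto
  ultimately obtain p q where pq: "e = closed_segment p q"
    using compact_convex_collinear_segment polytope_imp_compact[OF assms(1)]
      polytope_imp_convex[OF assms(1)] by metis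
  then have "p \<noteq> q" using assms(2) by auto
  with pq show thesis by (rule that)
qed

text \<open>The vertex figure of a polygon is a segment, and a segment has two endpoints.\<close>

lemma card_edges_at_polygon_vertex:
  fixes F :: "'a::euclidean_space set"
  assumes "polytope F" "aff_dim F = 2" "v extreme_point_of F"
  shows "card {e \<in> dim_faces 1 F. v \<in> e} = 2"
proof -
  obtain a b where ab: "cuts_off F v a b" using exists_cuts_off[OF assms(1,3)] by blast
  have ne: "F \<noteq> {v}" using assms(2) by auto
  have "aff_dim (slice F a b) = 1" using aff_dim_slice[OF assms(1) ab ne] assms(2) by simp
  then obtain p q where pq: "slice F a b = closed_segment p q" "p \<noteq> q"
    using one_dim_polytope_segment polytope_slice[OF assms(1)] by blast
  have "slice {v} a b = {}" using ab by (auto simp: cuts_off_def)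
  then have "bij_betw (\<lambda>F. slice F a b) {e \<in> dim_faces 1 F. v \<in> e} (dim_faces 0 (slice F a b))"
    using bij_betw_slice[OF assms(1) ab, of 0 "{v}"] assms(3) by (simp add: face_of_singleton)
  moreover have "dim_faces 0 (slice F a b) = {{p}, {q}}"
    unfolding dim_faces_0 pq extreme_point_of_segment by auto
  ultimately show ?thesis using pq(2) by (simp add: bij_betw_same_card)
qed

lemma edge_segment:
  fixes P :: "'a::euclidean_space set"
  assumes "polytope P" "e \<in> dim_faces 1 P"
  obtains p q where "e = closed_segment p q" "p \<noteq> q" "p extreme_point_of P" "q extreme_point_of P"
proof -
  have e: "e face_of P" "aff_dim e = 1" using assms(2) by (auto simp: dim_faces_def)
  then obtain p q where pq: "e = closed_segment p q" "p \<noteq> q"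
    using one_dim_polytope_segment assms(1) face_of_polytope_polytope by blast
  have "p extreme_point_of e" "q extreme_point_of e" using pq by (simp_all add: extreme_point_of_segment)
  then show thesis using that pq extreme_point_of_face[OF e(1)] by blast
qed

lemma card_vertices_of_edge:
  fixes P :: "'a::euclidean_space set"
  assumes "polytope P" "e \<in> dim_faces 1 P"
  shows "card {v. v extreme_point_of P \<and> v \<in> e} = 2"
proof -
  obtain p q where pq: "e = closed_segment p q" "p \<noteq> q" using edge_segment[OF assms] by blast
  have "e face_of P" using assms by (simp add: dim_faces_def)
  then have "{v. v extreme_point_of P \<and> v \<in> e} = {v. v extreme_point_of e}"
    using extreme_point_of_face by blast
  also have "\<dots> = {p, q}" by (auto simp: pq extreme_point_of_segment)
  finally show ?thesis using pq(2) by simp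
qed

text \<open>In the vertex figure at an end of \<open>e\<close>, which is a polygon, \<open>e\<close> becomes a vertex and the facets
through \<open>e\<close> become the edges at that vertex.\<close>

lemma card_facets_at_edge:
  fixes P :: "'a::euclidean_space set"
  assumes "polytope P" "aff_dim P = 3" "e \<in> dim_faces 1 P"
  shows "card {F \<in> dim_faces 2 P. e \<subseteq> F} = 2"
proof -
  obtain v where v: "v extreme_point_of P" "v \<in> e"
    using edge_segment[OF assms(1,3)] by (metis ends_in_segment(1))
  have e: "e face_of P" "aff_dim e = 1" using assms(3) by (auto simp: dim_faces_def)
  obtain a b where ab: "cuts_off P v a b" using exists_cuts_off[OF assms(1) v(1)] by blast
  have "P \<noteq> {v}" "e \<noteq> {v}" using assms(2) e(2) by auto
  note S = slice_of_face[OF assms(1) ab e(1) v(2) \<open>e \<noteq> {v}\<close>]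
  have "aff_dim (slice e a b) = 0" using S e by simp
  then obtain q where q: "slice e a b = {q}" using aff_dim_eq_0 by blast
  then have "q extreme_point_of slice P a b" using S(1) face_of_singleton by metis
  moreover have "aff_dim (slice P a b) = 2"
    using aff_dim_slice[OF assms(1) ab \<open>P \<noteq> {v}\<close>] assms(2) by simp
  ultimately have "card {G \<in> dim_faces 1 (slice P a b). q \<in> G} = 2"
    by (intro card_edges_at_polygon_vertex polytope_slice[OF assms(1)])
  then show ?thesis
    using bij_betw_same_card[OF bij_betw_slice[OF assms(1) ab, of 1 e]] e(1) v(2) q by simp
qed

section \<open>Walking along the edges of a polytope\<close>

lemma edge_at_vertex:
  fixes P :: "'a::euclidean_space set"
  assumes "polytope P" "e \<in> dim_faces 1 P" "v \<in> e" "v extreme_point_of P"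
  obtains w where "e = closed_segment v w" "w \<noteq> v" "w extreme_point_of P"
proof -
  obtain p q where pq: "e = closed_segment p q" "p \<noteq> q" "p extreme_point_of P" "q extreme_point_of P"
    using edge_segment[OF assms(1,2)] .
  have "v extreme_point_of e"
    using assms extreme_point_of_face by (auto simp: dim_faces_def)
  then have "v = p \<or> v = q" by (simp add: pq(1) extreme_point_of_segment)
  then show thesis using that pq closed_segment_commute by metis
qed

lemma edge_slice_point:
  fixes P :: "'a::euclidean_space set"
  assumes "polytope P" "cuts_off P v a b" "e \<in> dim_faces 1 P" "v \<in> e"
  obtains w q t where "e = closed_segment v w" "w \<noteq> v" "w extreme_point_of P"
    "slice e a b = {q}" "q extreme_point_of slice P a b" "q = v + t *\<^sub>R (w - v)" "0 < t" "t < 1"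
proof -
  have v: "v extreme_point_of P" using assms(2) by (simp add: cuts_off_def)
  obtain w where w: "e = closed_segment v w" "w \<noteq> v" "w extreme_point_of P"
    using edge_at_vertex[OF assms(1,3,4) v] .
  have e: "e face_of P" "aff_dim e = 1" using assms(3) by (auto simp: dim_faces_def)
  then have "e \<noteq> {v}" by auto
  note S = slice_of_face[OF assms(1,2) e(1) assms(4) this]
  have "aff_dim (slice e a b) = 0" using S(3) e(2) by simp
  then obtain q where q: "slice e a b = {q}" using aff_dim_eq_0 by blast
  then have qe: "q extreme_point_of slice P a b" using S(1) face_of_singleton by metis
  have qq: "q \<in> e" "a \<bullet> q = b" using q by blast+
  then obtain t where t: "0 \<le> t" "t \<le> 1" "q = (1 - t) *\<^sub>R v + t *\<^sub>R w"
    unfolding w(1) closed_segment_def by blast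
  have "a \<bullet> v < b" "b < a \<bullet> w" using assms(2) w(2,3) by (auto simp: cuts_off_def)
  then have "t \<noteq> 0" "t \<noteq> 1" using t(3) qq(2) by auto
  then have "0 < t" "t < 1" using t by simp_all
  moreover have "q = v + t *\<^sub>R (w - v)" using t(3) by (simp add: algebra_simps)
  ultimately show thesis using that w q qe by blast
qed

lemma slice_vertex_lift:
  fixes P :: "'a::euclidean_space set"
  assumes "polytope P" "cuts_off P v a b" "q extreme_point_of slice P a b"
  obtains e where "e \<in> dim_faces 1 P" "v \<in> e" "slice e a b = {q}"
proof -
  have "{q} face_of slice P a b" using assms(3) by (simp add: face_of_singleton)
  then obtain e where e: "e face_of P" "v \<in> e" "e \<noteq> {v}" "slice e a b = {q}"
    using face_of_slice_lift[OF assms(1,2)] by (metis insert_not_empty)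
  have "aff_dim e = 1"
    using slice_of_face(3)[OF assms(1,2) e(1-3)] e(4) by simp
  then show thesis using that e by (auto simp: dim_faces_def)
qed

text \<open>The principle behind the simplex algorithm. The vertex figure at \<open>v\<close> is spanned by points on the
edges at \<open>v\<close>, so the bound holds on it, and every other vertex of \<open>P\<close> lies on a ray from \<open>v\<close> through it.\<close>

lemma vertex_max_if_max_on_edges:
  fixes P :: "'a::euclidean_space set"
  assumes "polytope P" "v extreme_point_of P"
    and "\<And>e z. e \<in> dim_faces 1 P \<Longrightarrow> v \<in> e \<Longrightarrow> z \<in> e \<Longrightarrow> c \<bullet> z \<le> c \<bullet> v"
    and "z \<in> P"
  shows "c \<bullet> z \<le> c \<bullet> v"
proof -
  obtain a b where ab: "cuts_off P v a b" using exists_cuts_off[OF assms(1,2)] by blast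
  have "{q. q extreme_point_of slice P a b} \<subseteq> {z. c \<bullet> z \<le> c \<bullet> v}"
  proof clarify
    fix q assume q: "q extreme_point_of slice P a b"
    obtain e where "e \<in> dim_faces 1 P" "v \<in> e" "slice e a b = {q}"
      using slice_vertex_lift[OF assms(1) ab q] .
    then show "c \<bullet> q \<le> c \<bullet> v" using assms(3) by blast
  qed
  then have "convex hull {q. q extreme_point_of slice P a b} \<subseteq> {z. c \<bullet> z \<le> c \<bullet> v}"
    by (simp add: convex_halfspace_le hull_minimal)
  then have le: "c \<bullet> q \<le> c \<bullet> v" if "q \<in> slice P a b" for q
    using that polytope_eq_hull[OF polytope_slice[OF assms(1)]] by blast
  have vP: "v \<in> P" using assms(2) by (simp add: extreme_point_of_def)
  have "{z. z extreme_point_of P} \<subseteq> {z. c \<bullet> z \<le> c \<bullet> v}"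
  proof clarify
    fix z assume z: "z extreme_point_of P"
    then have zP: "z \<in> P" by (simp add: extreme_point_of_def)
    show "c \<bullet> z \<le> c \<bullet> v"
    proof (cases "z = v")
      case False
      then have lt: "a \<bullet> v < b" "b < a \<bullet> z" using ab z by (auto simp: cuts_off_def)
      define t where "t = (b - a \<bullet> v) / (a \<bullet> z - a \<bullet> v)"
      have t: "0 < t" "t \<le> 1" using lt by (auto simp: t_def)
      have "(1 - t) *\<^sub>R v + t *\<^sub>R z \<in> P"
        using polytope_imp_convex[OF assms(1)] vP zP t by (intro convexD) auto
      moreover have "t * (a \<bullet> z - a \<bullet> v) = b - a \<bullet> v" using lt by (simp add: t_def)
      then have "a \<bullet> ((1 - t) *\<^sub>R v + t *\<^sub>R z) = b"
        by (simp add: algebra_simps)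
      ultimately have "c \<bullet> ((1 - t) *\<^sub>R v + t *\<^sub>R z) \<le> c \<bullet> v" by (intro le) blast
      then have "t * (c \<bullet> z) \<le> t * (c \<bullet> v)" by (simp add: algebra_simps)
      then show ?thesis using t(1) by simp
    qed simp
  qed
  then have "convex hull {z. z extreme_point_of P} \<subseteq> {z. c \<bullet> z \<le> c \<bullet> v}"
    by (simp add: convex_halfspace_le hull_minimal)
  then show ?thesis using assms(4) polytope_eq_hull[OF assms(1)] by blast
qed

lemma improving_edge:
  fixes P :: "'a::euclidean_space set"
  assumes "polytope P" "v extreme_point_of P" "z \<in> P" "c \<bullet> v < c \<bullet> z"
  obtains w where "w extreme_point_of P" "closed_segment v w \<in> dim_faces 1 P" "c \<bullet> v < c \<bullet> w"
proof -
  obtain e y where e: "e \<in> dim_faces 1 P" "v \<in> e" "y \<in> e" "c \<bullet> v < c \<bullet> y"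
    using vertex_max_if_max_on_edges[OF assms(1,2) _ assms(3), of c] assms(4) by (meson not_le)
  obtain w where w: "e = closed_segment v w" "w \<noteq> v" "w extreme_point_of P"
    using edge_at_vertex[OF assms(1) e(1,2) assms(2)] .
  obtain t where t: "0 \<le> t" "y = (1 - t) *\<^sub>R v + t *\<^sub>R w"
    using e(3) unfolding w(1) closed_segment_def by blast
  have "t * (c \<bullet> w - c \<bullet> v) > 0" using e(4) t(2) by (simp add: algebra_simps)
  then have "c \<bullet> v < c \<bullet> w" using t(1) by (simp add: zero_less_mult_iff)
  then show thesis using that w e(1) by blast
qed

lemma finite_obtains_min:
  fixes f :: "'a \<Rightarrow> real"
  assumes "finite S" "S \<noteq> {}"
  obtains v where "v \<in> S" "\<And>w. w \<in> S \<Longrightarrow> f v \<le> f w"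
proof (rule that[of "arg_min_on f S"])
  show "arg_min_on f S \<in> S" by (rule arg_min_if_finite(1)[OF assms])
  show "f (arg_min_on f S) \<le> f w" if "w \<in> S" for w by (rule arg_min_least[OF assms that])
qed

text \<open>Descend from \<open>u\<close> to \<open>x\<close> along a functional with its minimum only at \<open>x\<close>: the lowest vertex in
\<open>S\<close> has no descending edge, hence is \<open>x\<close>.\<close>

lemma skeleton_connected:
  fixes P :: "'a::euclidean_space set"
  assumes "polytope P" "u \<in> S" "S \<subseteq> {v. v extreme_point_of P}"
    and step: "\<And>v w. v \<in> S \<Longrightarrow> w extreme_point_of P \<Longrightarrow> closed_segment v w \<in> dim_faces 1 P \<Longrightarrow> w \<in> S"
    and x: "x extreme_point_of P"
  shows "x \<in> S"
proof -
  obtain a b where ab: "cuts_off P x a b" using exists_cuts_off[OF assms(1) x] by blast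
  have "finite S" using finite_extreme_points[OF assms(1)] assms(3) finite_subset by blast
  then obtain v where v: "v \<in> S" "\<And>w. w \<in> S \<Longrightarrow> a \<bullet> v \<le> a \<bullet> w"
    using finite_obtains_min[of S "\<lambda>w. a \<bullet> w"] assms(2) by blast
  have "v = x"
  proof (rule ccontr)
    assume "v \<noteq> x"
    then have "(- a) \<bullet> v < (- a) \<bullet> x" using ab v(1) assms(3) by (force simp: cuts_off_def)
    moreover have "x \<in> P" using x by (simp add: extreme_point_of_def)
    ultimately obtain w where "w extreme_point_of P" "closed_segment v w \<in> dim_faces 1 P"
      "(- a) \<bullet> v < (- a) \<bullet> w"
      using improving_edge[OF assms(1), of v x "- a"] v(1) assms(3) by blast
    then show False using step[OF v(1)] v(2)[of w] by simp
  qed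
  then show ?thesis using v by simp
qed

section \<open>Half of the Euler formula\<close>

text \<open>A generic functional is built by perturbing one that works for all but one vector.\<close>

lemma exists_generic_functional:
  fixes D :: "'a::euclidean_space set"
  assumes "finite D" "0 \<notin> D"
  shows "\<exists>c. \<forall>d\<in>D. c \<bullet> d \<noteq> 0"
  using assms
proof (induction D)
  case (insert d D)
  then obtain c where c: "\<forall>x\<in>D. c \<bullet> x \<noteq> 0" by auto
  show ?case
  proof (cases "c \<bullet> d = 0")
    case True
    obtain r :: real where r: "r \<notin> insert 0 ((\<lambda>x. - (c \<bullet> x) / (d \<bullet> x)) ` D)"
      using ex_new_if_finite[OF infinite_UNIV_char_0] insert.hyps(1) by (metis finite_imageI finite_insert)
    have "(c + r *\<^sub>R d) \<bullet> d \<noteq> 0" using True r insert.prems by (auto simp: inner_simps)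
    moreover have "(c + r *\<^sub>R d) \<bullet> x \<noteq> 0" if "x \<in> D" for x
    proof (cases "d \<bullet> x = 0")
      case False
      have "r \<noteq> - (c \<bullet> x) / (d \<bullet> x)" using r that by blast
      then show ?thesis using False by (simp add: inner_simps field_simps)
    qed (use c that in \<open>simp add: inner_simps\<close>)
    ultimately show ?thesis by blast
  qed (use c in blast)
qed simp

definition top_vertex :: "'a::euclidean_space \<Rightarrow> 'a set \<Rightarrow> 'a \<Rightarrow> bool" where
  "top_vertex c F v \<longleftrightarrow> v \<in> F \<and> (\<forall>z\<in>F. c \<bullet> z \<le> c \<bullet> v)"

lemma card_top_vertices:
  fixes P :: "'a::euclidean_space set"
  assumes "polytope P" "inj_on ((\<bullet>) c) {v. v extreme_point_of P}" "F face_of P" "F \<noteq> {}"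
  shows "card {v \<in> {v. v extreme_point_of P}. top_vertex c F v} = 1"
proof -
  let ?E = "{v. v extreme_point_of F}"
  have pF: "polytope F" using assms face_of_polytope_polytope by blast
  have F: "F = convex hull ?E" using polytope_eq_hull[OF pF] .
  then have "?E \<noteq> {}" using assms(4) by auto
  moreover have "finite ?E" using finite_extreme_points[OF pF] .
  ultimately obtain v where v: "v \<in> ?E" "\<And>w. w \<in> ?E \<Longrightarrow> - (c \<bullet> v) \<le> - (c \<bullet> w)"
    using finite_obtains_min[of ?E "\<lambda>w. - (c \<bullet> w)"] by blast
  have "?E \<subseteq> {z. c \<bullet> z \<le> c \<bullet> v}" using v(2) by auto
  then have "convex hull ?E \<subseteq> {z. c \<bullet> z \<le> c \<bullet> v}"
    by (simp add: convex_halfspace_le hull_minimal)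
  then have "top_vertex c F v" using F v(1) by (auto simp: top_vertex_def extreme_point_of_def)
  moreover have "v extreme_point_of P" using v(1) extreme_point_of_face[OF assms(3)] by blast
  moreover have "w = v" if "w extreme_point_of P" "top_vertex c F w" for w
  proof -
    have "c \<bullet> w = c \<bullet> v" using that(2) \<open>top_vertex c F v\<close> by (auto simp: top_vertex_def intro: antisym)
    then show ?thesis using assms(2) that(1) \<open>v extreme_point_of P\<close> by (auto simp: inj_on_def)
  qed
  ultimately have "{v \<in> {v. v extreme_point_of P}. top_vertex c F v} = {v}" by blast
  then show ?thesis by simp
qed

text \<open>Sweeping \<open>P\<close> in direction \<open>c\<close>: at \<open>v\<close> the descending edges outnumber the facets with top \<open>v\<close> by
at most one. The descending edges are the vertices of the vertex figure lower than \<open>v\<close>. Each of these other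
than the lowest one, \<open>q0\<close>, has an edge of the vertex figure going further down; that edge is the slice of
a facet whose edges at \<open>v\<close> both descend, so \<open>v\<close> is the top of this facet. Different vertices yield different facets,
being the upper ends of the corresponding edges of the vertex figure.\<close>

lemma card_descending_edges_le:
  fixes P :: "'a::euclidean_space set"
  assumes "polytope P" "cuts_off P v a b"
    and "inj_on ((\<bullet>) c) {w. w extreme_point_of P}"
    and "inj_on ((\<bullet>) c) {q. q extreme_point_of slice P a b}"
  shows "card {e \<in> dim_faces 1 P. top_vertex c e v} \<le> card {F \<in> dim_faces 2 P. top_vertex c F v} + 1"
proof -
  let ?Q = "slice P a b"
  let ?E = "{e \<in> dim_faces 1 P. top_vertex c e v}" and ?F = "{F \<in> dim_faces 2 P. top_vertex c F v}"
  define S where "S = {q. q extreme_point_of ?Q \<and> c \<bullet> q < c \<bullet> v}"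
  have v: "v extreme_point_of P" using assms(2) by (simp add: cuts_off_def)
  have pQ: "polytope ?Q" by (rule polytope_slice[OF assms(1)])
  have finS: "finite S" using finite_extreme_points[OF pQ] by (simp add: S_def)
  have finF: "finite ?F" using finite_dim_faces[OF assms(1), of 2] by simp
  have "card ?E \<le> card ((\<lambda>q. {q}) ` S)"
  proof (rule card_inj_on_le)
    show "inj_on (\<lambda>e. slice e a b) ?E"
    proof -
      have "inj_on (\<lambda>F. slice F a b) {F \<in> dim_faces 1 P. {v} \<subseteq> F}"
        using bij_betw_slice[OF assms(1,2), of 0 "{v}"] v
        by (simp add: bij_betw_def face_of_singleton)
      then show ?thesis by (rule inj_on_subset) (auto simp: top_vertex_def)
    qed
    show "(\<lambda>e. slice e a b) ` ?E \<subseteq> (\<lambda>q. {q}) ` S"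
    proof clarify
      fix e assume e: "e \<in> dim_faces 1 P" "top_vertex c e v"
      then have "v \<in> e" by (simp add: top_vertex_def)
      obtain w q t where wq: "e = closed_segment v w" "w \<noteq> v" "w extreme_point_of P"
        "slice e a b = {q}" "q extreme_point_of ?Q" "q = v + t *\<^sub>R (w - v)" "0 < t" "t < 1"
        using edge_slice_point[OF assms(1,2) e(1) \<open>v \<in> e\<close>] .
      have "c \<bullet> w \<noteq> c \<bullet> v" using assms(3) v wq(2,3) by (auto simp: inj_on_def)
      moreover have "c \<bullet> w \<le> c \<bullet> v" using e(2) wq(1) by (auto simp: top_vertex_def)
      ultimately have "t * (c \<bullet> w - c \<bullet> v) < 0" using wq(7) by (simp add: mult_pos_neg)
      moreover have "c \<bullet> q = c \<bullet> v + t * (c \<bullet> w - c \<bullet> v)"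
        using wq(6) by (simp add: inner_add_right inner_diff_right)
      ultimately have "c \<bullet> q < c \<bullet> v" by simp
      then show "slice e a b \<in> (\<lambda>q. {q}) ` S" using wq(4,5) by (auto simp: S_def)
    qed
    show "finite ((\<lambda>q. {q}) ` S)" using finS by simp
  qed
  then have E: "card ?E \<le> card S" using card_image_le[OF finS, of "\<lambda>q. {q}"] by linarith
  have "card S \<le> card ?F + 1"
  proof (cases "S = {}")
    case False
    then obtain q0 where q0: "q0 \<in> S" "\<And>q. q \<in> S \<Longrightarrow> c \<bullet> q0 \<le> c \<bullet> q"
      using finite_obtains_min[OF finS, of "\<lambda>w. c \<bullet> w"] by blast
    define step where "step q F q' \<longleftrightarrow> F \<in> ?F \<and> slice F a b = closed_segment q q' \<and> c \<bullet> q' < c \<bullet> q"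
      for q F q'
    have "\<exists>F q'. step q F q'" if q: "q \<in> S - {q0}" for q
    proof -
      have qe: "q extreme_point_of ?Q" "c \<bullet> q < c \<bullet> v" using q by (auto simp: S_def)
      have q0e: "q0 extreme_point_of ?Q" using q0 by (simp add: S_def)
      have "c \<bullet> q0 \<noteq> c \<bullet> q" using assms(4) q qe(1) q0e by (auto simp: inj_on_def)
      then have "(- c) \<bullet> q < (- c) \<bullet> q0" using q0(2)[of q] q by simp
      moreover have "q0 \<in> ?Q" using q0e by (simp add: extreme_point_of_def)
      ultimately obtain q' where q': "q' extreme_point_of ?Q" "closed_segment q q' \<in> dim_faces 1 ?Q"
        "(- c) \<bullet> q < (- c) \<bullet> q'"
        using improving_edge[OF pQ qe(1)] by blast
      obtain F where F: "F face_of P" "v \<in> F" "F \<noteq> {v}" "slice F a b = closed_segment q q'"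
        using face_of_slice_lift[OF assms(1,2), of "closed_segment q q'"] q'(2)
        by (auto simp: dim_faces_def)
      have dF: "F \<in> dim_faces 2 P"
        using slice_of_face(3)[OF assms(1,2) F(1-3)] F(1,4) q'(2) by (simp add: dim_faces_def)
      have pF: "polytope F" and cF: "cuts_off F v a b"
        using F assms face_of_polytope_polytope cuts_off_face by blast+
      have vF: "v extreme_point_of F" using v F(1,2) extreme_point_of_face by blast
      have "c \<bullet> z \<le> c \<bullet> v" if "z \<in> F" for z
      proof (rule vertex_max_if_max_on_edges[OF pF vF _ that])
        fix e y assume e: "e \<in> dim_faces 1 F" "v \<in> e" "y \<in> e"
        obtain w p t where wp: "e = closed_segment v w" "w \<noteq> v" "w extreme_point_of F"
          "slice e a b = {p}" "p extreme_point_of slice F a b" "p = v + t *\<^sub>R (w - v)" "0 < t" "t < 1"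
          using edge_slice_point[OF pF cF e(1,2)] .
        have "p = q \<or> p = q'" using wp(5) by (simp add: F(4) extreme_point_of_segment)
        then have "c \<bullet> p < c \<bullet> v" using qe(2) q'(3) by auto
        moreover have "c \<bullet> p = c \<bullet> v + t * (c \<bullet> w - c \<bullet> v)"
          using wp(6) by (simp add: inner_add_right inner_diff_right)
        ultimately have "t * (c \<bullet> w - c \<bullet> v) < 0" by simp
        then have "c \<bullet> w < c \<bullet> v" using wp(7) by (simp add: mult_less_0_iff)
        moreover obtain s where s: "0 \<le> s" "y = (1 - s) *\<^sub>R v + s *\<^sub>R w"
          using e(3) unfolding wp(1) closed_segment_def by blast
        ultimately have "s * (c \<bullet> w - c \<bullet> v) \<le> 0" by (intro mult_nonneg_nonpos) simp_all
        moreover have "c \<bullet> y = c \<bullet> v + s * (c \<bullet> w - c \<bullet> v)"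
          unfolding s(2) by (simp add: algebra_simps)
        ultimately show "c \<bullet> y \<le> c \<bullet> v" by simp
      qed
      then have "F \<in> ?F" using dF F(2) by (simp add: top_vertex_def)
      then have "step q F q'" using F(4) q'(3) by (simp add: step_def)
      then show ?thesis by blast
    qed
    then obtain f n where "\<And>q. q \<in> S - {q0} \<Longrightarrow> step q (f q) (n q)" by metis
    then have f: "f q \<in> ?F \<and> slice (f q) a b = closed_segment q (n q) \<and> c \<bullet> n q < c \<bullet> q"
      if "q \<in> S - {q0}" for q
      using that unfolding step_def by blast
    have le: "c \<bullet> q1 \<le> c \<bullet> q2" if "q1 \<in> S - {q0}" "q2 \<in> S - {q0}" "f q1 = f q2" for q1 q2
    proof -
      have "closed_segment q1 (n q1) = closed_segment q2 (n q2)"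
        using f[OF that(1)] f[OF that(2)] that(3) by simp
      then have "q1 \<in> closed_segment q2 (n q2)" using ends_in_segment(1)[of q1 "n q1"] by blast
      then obtain s where s: "0 \<le> s" "q1 = (1 - s) *\<^sub>R q2 + s *\<^sub>R n q2"
        unfolding closed_segment_def by blast
      have "s * (c \<bullet> n q2 - c \<bullet> q2) \<le> 0" using f[OF that(2)] s(1) by (simp add: mult_nonneg_nonpos)
      moreover have "c \<bullet> q1 = c \<bullet> q2 + s * (c \<bullet> n q2 - c \<bullet> q2)"
        unfolding s(2) by (simp add: algebra_simps)
      ultimately show ?thesis by simp
    qed
    have "inj_on f (S - {q0})"
    proof (rule inj_onI)
      fix q1 q2 assume q: "q1 \<in> S - {q0}" "q2 \<in> S - {q0}" "f q1 = f q2"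
      then have "c \<bullet> q1 = c \<bullet> q2" using le[of q1 q2] le[of q2 q1] by simp
      then show "q1 = q2" using assms(4) q by (auto simp: inj_on_def S_def)
    qed
    then have "card (S - {q0}) \<le> card ?F" by (rule card_inj_on_le) (use f finF in auto)
    then show ?thesis using finS q0(1) by simp
  qed simp
  with E show ?thesis by linarith
qed

text \<open>Every edge and every facet has a unique top vertex, so both can be counted by their tops. Summing
\<open>card_descending_edges_le\<close> over all vertices gives \<open>E \<le> V + F\<close>, and the lowest vertex makes the inequality strict
because it is the top of no edge.\<close>

lemma euler_inequality:
  fixes P :: "'a::euclidean_space set"
  assumes "polytope P" "aff_dim P = 3"
  shows "card (dim_faces 1 P) < card {v. v extreme_point_of P} + card (dim_faces 2 P)"
proof -
  let ?V = "{v. v extreme_point_of P}"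
  have finV: "finite ?V" by (rule finite_extreme_points[OF assms(1)])
  have fin: "finite (dim_faces k P)" for k by (rule finite_dim_faces[OF assms(1)])
  obtain a b where ab: "\<And>v. v \<in> ?V \<Longrightarrow> cuts_off P v (a v) (b v)"
    using exists_cuts_off[OF assms(1)] by (metis mem_Collect_eq)
  define X where "X v = {q. q extreme_point_of slice P (a v) (b v)}" for v
  \<comment> \<open>c has to separate the vertices of P and the vertices of each of the chosen vertex figures\<close>
  define D where "D A = (\<lambda>(p, q). p - q) ` (A \<times> A) - {0}" for A :: "'a set"
  have finX: "finite (X v)" for v
    unfolding X_def by (rule finite_extreme_points[OF polytope_slice[OF assms(1)]])
  have "finite (D ?V \<union> (\<Union>v\<in>?V. D (X v)))" using finV finX by (auto simp: D_def)
  moreover have "0 \<notin> D ?V \<union> (\<Union>v\<in>?V. D (X v))" by (simp add: D_def)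
  ultimately obtain c where c: "\<forall>d\<in>D ?V \<union> (\<Union>v\<in>?V. D (X v)). c \<bullet> d \<noteq> 0"
    using exists_generic_functional by blast
  have inj: "inj_on ((\<bullet>) c) A" if "\<forall>d\<in>D A. c \<bullet> d \<noteq> 0" for A
  proof (rule inj_onI)
    fix p q assume pq: "p \<in> A" "q \<in> A" "c \<bullet> p = c \<bullet> q"
    show "p = q"
    proof (rule ccontr)
      assume "p \<noteq> q"
      then have "p - q \<in> D A" using pq by (auto simp: D_def)
      then show False using that pq(3) by (auto simp: inner_simps)
    qed
  qed
  have injV: "inj_on ((\<bullet>) c) ?V" using c by (intro inj) blast
  have le: "card {e \<in> dim_faces 1 P. top_vertex c e v} \<le> card {F \<in> dim_faces 2 P. top_vertex c F v} + 1"
    if "v \<in> ?V" for v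
  proof (rule card_descending_edges_le[OF assms(1) ab[OF that] injV])
    show "inj_on ((\<bullet>) c) {q. q extreme_point_of slice P (a v) (b v)}"
      using c that unfolding X_def[symmetric] by (intro inj) blast
  qed
  have one: "\<forall>F\<in>dim_faces k P. card {v \<in> ?V. top_vertex c F v} = 1" if "k \<ge> 0" for k
  proof
    fix F assume "F \<in> dim_faces k P"
    then have "F face_of P" "F \<noteq> {}" using that by (auto simp: dim_faces_def)
    then show "card {v \<in> ?V. top_vertex c F v} = 1" by (rule card_top_vertices[OF assms(1) injV])
  qed
  have "?V \<noteq> {}"
  proof
    assume "?V = {}"
    then have "P = {}" using polytope_eq_hull[OF assms(1)] by (metis convex_hull_empty)
    then show False using assms(2) by simp
  qed
  then obtain v0 where v0: "v0 \<in> ?V" "\<And>w. w \<in> ?V \<Longrightarrow> c \<bullet> v0 \<le> c \<bullet> w"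
    using finite_obtains_min[OF finV, of "\<lambda>w. c \<bullet> w"] by blast
  have none: "{e \<in> dim_faces 1 P. top_vertex c e v0} = {}"
  proof (rule ccontr)
    assume "\<not> ?thesis"
    then obtain e where e: "e \<in> dim_faces 1 P" "top_vertex c e v0" by blast
    then have "v0 \<in> e" by (simp add: top_vertex_def)
    then obtain w where w: "e = closed_segment v0 w" "w \<noteq> v0" "w extreme_point_of P"
      using edge_at_vertex[OF assms(1) e(1)] v0(1) by blast
    then have "c \<bullet> w \<le> c \<bullet> v0" using e(2) by (auto simp: top_vertex_def)
    then have "c \<bullet> w = c \<bullet> v0" using v0(2)[of w] w(3) by simp
    then show False using injV w v0(1) by (auto simp: inj_on_def)
  qed
  have lt: "card {e \<in> dim_faces 1 P. top_vertex c e v0} < card {F \<in> dim_faces 2 P. top_vertex c F v0} + 1"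
    unfolding none by simp
  have "card (dim_faces 1 P) = (\<Sum>v\<in>?V. card {e \<in> dim_faces 1 P. top_vertex c e v})"
    using sum_multicount[OF finV fin one, of 1] by simp
  also have "\<dots> < (\<Sum>v\<in>?V. card {F \<in> dim_faces 2 P. top_vertex c F v} + 1)"
    using le lt v0(1) by (intro sum_strict_mono_ex1[OF finV]) auto
  also have "\<dots> = (\<Sum>v\<in>?V. card {F \<in> dim_faces 2 P. top_vertex c F v}) + card ?V"
    by (simp only: sum.distrib card_eq_sum)
  also have "(\<Sum>v\<in>?V. card {F \<in> dim_faces 2 P. top_vertex c F v}) = card (dim_faces 2 P)"
    using sum_multicount[OF finV fin one, of 2] by simp
  finally show ?thesis by simp
qed

lemma card_polygon_vertices_ge_3:
  fixes F :: "'a::euclidean_space set"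
  assumes "polytope F" "aff_dim F = 2"
  shows "card {v. v extreme_point_of F} \<ge> 3"
proof -
  have "aff_dim F = aff_dim {v. v extreme_point_of F}"
    using polytope_eq_hull[OF assms(1)] aff_dim_convex_hull by metis
  then show ?thesis
    using aff_dim_le_card[OF finite_extreme_points[OF assms(1)]] assms(2) by linarith
qed

lemma card_polygon_edges:
  fixes F :: "'a::euclidean_space set"
  assumes "polytope F" "aff_dim F = 2"
  shows "card (dim_faces 1 F) = card {v. v extreme_point_of F}"
proof -
  let ?V = "{v. v extreme_point_of F}"
  have "2 * card ?V = (\<Sum>v\<in>?V. card {e \<in> dim_faces 1 F. v \<in> e})"
    using card_edges_at_polygon_vertex[OF assms] by simp
  also have "\<dots> = 2 * card (dim_faces 1 F)"
    using card_vertices_of_edge[OF assms(1)]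
    by (intro sum_multicount finite_extreme_points finite_dim_faces assms) simp
  finally show ?thesis by simp
qed

lemma card_edges_at_vertex:
  fixes P :: "'a::euclidean_space set"
  assumes "polytope P" "cuts_off P v a b"
  shows "card {e \<in> dim_faces 1 P. v \<in> e} = card {q. q extreme_point_of slice P a b}"
proof -
  have v: "v extreme_point_of P" using assms(2) by (simp add: cuts_off_def)
  have "slice {v} a b = {}" using assms(2) by (auto simp: cuts_off_def)
  then have "bij_betw (\<lambda>F. slice F a b) {e \<in> dim_faces 1 P. v \<in> e} (dim_faces 0 (slice P a b))"
    using bij_betw_slice[OF assms(1,2), of 0 "{v}"] v by (simp add: face_of_singleton)
  then have "card {e \<in> dim_faces 1 P. v \<in> e} = card (dim_faces 0 (slice P a b))"
    by (rule bij_betw_same_card)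
  also have "\<dots> = card {q. q extreme_point_of slice P a b}"
    unfolding dim_faces_0 by (rule card_image) (simp add: inj_on_def)
  finally show ?thesis .
qed

lemma dim_faces_of_face:
  assumes "F face_of P" shows "dim_faces k F = {e \<in> dim_faces k P. e \<subseteq> F}"
  using face_of_face[OF assms] by (auto simp: dim_faces_def)

text \<open>If all vertices had degree at least four and all facets at least four edges, double counting would
give \<open>2 * V \<le> E\<close> and \<open>2 * F \<le> E\<close>, against \<open>E < V + F\<close>.\<close>

lemma trivalent_vertex_or_triangle:
  fixes P :: "'a::euclidean_space set"
  assumes "polytope P" "aff_dim P = 3"
  obtains v where "v extreme_point_of P" "card {e \<in> dim_faces 1 P. v \<in> e} = 3"
  | F where "F \<in> dim_faces 2 P" "card {v. v extreme_point_of F} = 3"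
proof (rule ccontr)
  note euler = euler_inequality[OF assms]
  let ?V = "{v. v extreme_point_of P}"
  assume "\<not> thesis"
  then have *: "\<And>v. v extreme_point_of P \<Longrightarrow> card {e \<in> dim_faces 1 P. v \<in> e} \<noteq> 3"
    "\<And>F. F \<in> dim_faces 2 P \<Longrightarrow> card {v. v extreme_point_of F} \<noteq> 3"
    using that by blast+
  have V4: "4 \<le> card {e \<in> dim_faces 1 P. v \<in> e}" if "v \<in> ?V" for v
  proof -
    obtain a b where ab: "cuts_off P v a b" using exists_cuts_off[OF assms(1)] \<open>v \<in> ?V\<close> by blast
    have "P \<noteq> {v}" using assms(2) by auto
    then have "aff_dim (slice P a b) = 2" using aff_dim_slice[OF assms(1) ab] assms(2) by simp
    then have "card {e \<in> dim_faces 1 P. v \<in> e} \<ge> 3"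
      using card_edges_at_vertex[OF assms(1) ab] card_polygon_vertices_ge_3[OF polytope_slice[OF assms(1)]]
      by metis
    then show ?thesis using *(1)[of v] \<open>v \<in> ?V\<close> by simp
  qed
  have F4: "4 \<le> card {e \<in> dim_faces 1 P. e \<subseteq> F}" if "F \<in> dim_faces 2 P" for F
  proof -
    have F: "F face_of P" "aff_dim F = 2" "polytope F"
      using that face_of_polytope_polytope[OF assms(1)] by (auto simp: dim_faces_def)
    have "card {e \<in> dim_faces 1 P. e \<subseteq> F} = card {v. v extreme_point_of F}"
      using card_polygon_edges[OF F(3,2)] dim_faces_of_face[OF F(1)] by metis
    then show ?thesis using card_polygon_vertices_ge_3[OF F(3,2)] *(2)[OF that] by simp
  qed
  have "4 * card ?V \<le> (\<Sum>v\<in>?V. card {e \<in> dim_faces 1 P. v \<in> e})"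
    using sum_mono[of ?V "\<lambda>_. 4" "\<lambda>v. card {e \<in> dim_faces 1 P. v \<in> e}"] V4 by simp
  also have "\<dots> = 2 * card (dim_faces 1 P)"
    using card_vertices_of_edge[OF assms(1)]
    by (intro sum_multicount finite_extreme_points finite_dim_faces assms) simp
  finally have V: "2 * card ?V \<le> card (dim_faces 1 P)" by simp
  have "4 * card (dim_faces 2 P) \<le> (\<Sum>F\<in>dim_faces 2 P. card {e \<in> dim_faces 1 P. e \<subseteq> F})"
    using sum_mono[of "dim_faces 2 P" "\<lambda>_. 4" "\<lambda>F. card {e \<in> dim_faces 1 P. e \<subseteq> F}"] F4 by simp
  also have "\<dots> = 2 * card (dim_faces 1 P)"
    using card_facets_at_edge[OF assms]
    by (intro sum_multicount finite_dim_faces assms) simp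
  finally show False using V euler by simp
qed

text \<open>There are two edges at \<open>u\<close> and only two possible other endpoints.\<close>

lemma triangle_sides:
  fixes F :: "'a::euclidean_space set"
  assumes "polytope F" "aff_dim F = 2" "card {v. v extreme_point_of F} = 3"
    and u: "u extreme_point_of F" and w: "w extreme_point_of F" and "u \<noteq> w"
  shows "closed_segment u w \<in> dim_faces 1 F"
proof -
  let ?V = "{v. v extreme_point_of F}"
  let ?N = "{w \<in> ?V - {u}. closed_segment u w \<in> dim_faces 1 F}"
  have finV: "finite ?V" by (rule finite_extreme_points[OF assms(1)])
  have "{e \<in> dim_faces 1 F. u \<in> e} \<subseteq> closed_segment u ` ?N"
  proof clarify
    fix e assume e: "e \<in> dim_faces 1 F" "u \<in> e"
    then obtain w where "e = closed_segment u w" "w \<noteq> u" "w extreme_point_of F"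
      using edge_at_vertex[OF assms(1) e u] by blast
    then show "e \<in> closed_segment u ` ?N" using e(1) by blast
  qed
  then have "2 \<le> card ?N"
    using card_edges_at_polygon_vertex[OF assms(1,2) u]
      surj_card_le[of ?N "{e \<in> dim_faces 1 F. u \<in> e}" "closed_segment u"] finV by simp
  moreover have "card (?V - {u}) = 2" using assms(3) u finV by simp
  ultimately have "?N = ?V - {u}" using finV by (intro card_seteq) auto
  then show ?thesis using w \<open>u \<noteq> w\<close> by blast
qed

section \<open>Passing from edge to edge through the corners of facets\<close>

text \<open>Two edges at \<open>v\<close> in a common facet are adjacent vertices of the vertex figure at \<open>v\<close>, so this is
the connectedness of the graph of the vertex figure.\<close>

lemma edges_connected_at_vertex:
  fixes P :: "'a::euclidean_space set"
  assumes "polytope P"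
    and step: "\<And>F e e' v. \<lbrakk>F \<in> dim_faces 2 P; e \<in> M; e' \<in> dim_faces 1 P; e \<subseteq> F; e' \<subseteq> F;
      v extreme_point_of P; v \<in> e; v \<in> e'\<rbrakk> \<Longrightarrow> e' \<in> M"
    and M: "M \<subseteq> dim_faces 1 P"
    and e: "e \<in> M" "v \<in> e" and v: "v extreme_point_of P" and e': "e' \<in> dim_faces 1 P" "v \<in> e'"
  shows "e' \<in> M"
proof -
  obtain a b where ab: "cuts_off P v a b" using exists_cuts_off[OF assms(1) v] by blast
  let ?Q = "slice P a b"
  have pQ: "polytope ?Q" by (rule polytope_slice[OF assms(1)])
  define S where "S = {q. q extreme_point_of ?Q \<and> (\<exists>e\<in>M. v \<in> e \<and> slice e a b = {q})}"
  have eP: "e face_of P \<and> e \<noteq> {v}" if "e \<in> dim_faces 1 P" for e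
    using that by (auto simp: dim_faces_def)
  obtain q where q: "slice e a b = {q}" "q extreme_point_of ?Q"
    using edge_slice_point[OF assms(1) ab _ e(2)] e(1) M by blast
  obtain q' where q': "slice e' a b = {q'}" "q' extreme_point_of ?Q"
    using edge_slice_point[OF assms(1) ab e'] by blast
  have "q' \<in> S"
  proof (rule skeleton_connected[OF pQ _ _ _ q'(2), of q])
    show "q \<in> S" using q e by (auto simp: S_def)
    show "S \<subseteq> {v. v extreme_point_of ?Q}" by (auto simp: S_def)
    fix p r assume p: "p \<in> S" and r: "r extreme_point_of ?Q" and pr: "closed_segment p r \<in> dim_faces 1 ?Q"
    obtain F where F: "F face_of P" "v \<in> F" "F \<noteq> {v}" "slice F a b = closed_segment p r"
      using face_of_slice_lift[OF assms(1) ab, of "closed_segment p r"] pr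
      by (auto simp: dim_faces_def)
    have dF: "F \<in> dim_faces 2 P"
      using slice_of_face(3)[OF assms(1) ab F(1-3)] F(1,4) pr by (simp add: dim_faces_def)
    obtain e1 where e1: "e1 \<in> M" "v \<in> e1" "slice e1 a b = {p}" using p by (auto simp: S_def)
    then have "e1 \<in> dim_faces 1 P" using M by blast
    obtain e2 where e2: "e2 \<in> dim_faces 1 P" "v \<in> e2" "slice e2 a b = {r}"
      using slice_vertex_lift[OF assms(1) ab r] .
    have "e1 \<subseteq> F" "e2 \<subseteq> F"
      using slice_mono_iff[OF assms(1) ab _ _ _ F(1), of e1] slice_mono_iff[OF assms(1) ab _ _ _ F(1), of e2]
        e1 e2 eP[OF \<open>e1 \<in> dim_faces 1 P\<close>] eP[OF e2(1)] F(4) by auto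
    then have "e2 \<in> M" using step[OF dF e1(1) e2(1) _ _ v e1(2) e2(2)] by blast
    then show "r \<in> S" using r e2 by (auto simp: S_def)
  qed
  then obtain e2 where e2: "e2 \<in> M" "v \<in> e2" "slice e2 a b = {q'}" by (auto simp: S_def)
  then have "e2 \<in> dim_faces 1 P" using M by blast
  then have "e2 = e'"
    using slice_mono_iff[OF assms(1) ab, of e2 e'] slice_mono_iff[OF assms(1) ab, of e' e2]
      eP[OF \<open>e2 \<in> dim_faces 1 P\<close>] eP[OF e'(1)] e2(2,3) e'(2) q'(1) by simp
  with e2 show ?thesis by simp
qed

text \<open>A property of edges that is passed on at every corner of every facet holds for all edges at a
vertex as soon as it holds for one of them, and so it spreads along the graph of \<open>P\<close>.\<close>

lemma edges_connected:
  fixes P :: "'a::euclidean_space set"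
  assumes "polytope P"
    and step: "\<And>F e e' v. \<lbrakk>F \<in> dim_faces 2 P; e \<in> M; e' \<in> dim_faces 1 P; e \<subseteq> F; e' \<subseteq> F;
      v extreme_point_of P; v \<in> e; v \<in> e'\<rbrakk> \<Longrightarrow> e' \<in> M"
    and M: "M \<subseteq> dim_faces 1 P" "M \<noteq> {}"
  shows "M = dim_faces 1 P"
proof
  have local: "e' \<in> M" if "e \<in> M" "v \<in> e" "v extreme_point_of P" "e' \<in> dim_faces 1 P" "v \<in> e'" for e e' v
    by (rule edges_connected_at_vertex[OF assms(1) _ M(1) that]) (rule step)
  define S where "S = {v. v extreme_point_of P \<and> (\<exists>e\<in>M. v \<in> e)}"
  obtain e0 where e0: "e0 \<in> M" using M(2) by blast
  obtain v0 where v0: "v0 extreme_point_of P" "v0 \<in> e0"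
    using edge_segment[OF assms(1)] e0 M(1) by (metis ends_in_segment(1) subsetD)
  show "dim_faces 1 P \<subseteq> M"
  proof
    fix e assume e: "e \<in> dim_faces 1 P"
    obtain v where v: "v extreme_point_of P" "v \<in> e"
      using edge_segment[OF assms(1) e] by (metis ends_in_segment(1))
    have "v \<in> S"
    proof (rule skeleton_connected[OF assms(1) _ _ _ v(1), of v0])
      show "v0 \<in> S" using v0 e0 by (auto simp: S_def)
      show "S \<subseteq> {v. v extreme_point_of P}" by (auto simp: S_def)
      fix u w assume u: "u \<in> S" "w extreme_point_of P" "closed_segment u w \<in> dim_faces 1 P"
      then have "closed_segment u w \<in> M" using local unfolding S_def by blast
      then show "w \<in> S" using u(2) by (auto simp: S_def)
    qed
    then show "e \<in> M" using local e v unfolding S_def by blast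
  qed
qed (rule M(1))

text \<open>The vertex figure at a vertex of degree three is a triangle, in which any two vertices are adjacent.\<close>

lemma trivalent_vertex_facets:
  fixes P :: "'a::euclidean_space set"
  assumes "polytope P" "aff_dim P = 3" "v extreme_point_of P" "card {e \<in> dim_faces 1 P. v \<in> e} = 3"
    and e: "e \<in> dim_faces 1 P" "v \<in> e" and e': "e' \<in> dim_faces 1 P" "v \<in> e'" and ne: "e \<noteq> e'"
  obtains F where "F \<in> dim_faces 2 P" "e \<subseteq> F" "e' \<subseteq> F"
proof -
  obtain a b where ab: "cuts_off P v a b" using exists_cuts_off[OF assms(1,3)] by blast
  let ?Q = "slice P a b"
  have pQ: "polytope ?Q" by (rule polytope_slice[OF assms(1)])
  have "P \<noteq> {v}" using assms(2) by auto
  then have d: "aff_dim ?Q = 2" using aff_dim_slice[OF assms(1) ab] assms(2) by simp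
  have c: "card {q. q extreme_point_of ?Q} = 3" using card_edges_at_vertex[OF assms(1) ab] assms(4) by simp
  have eP: "e face_of P \<and> e \<noteq> {v}" if "e \<in> dim_faces 1 P" for e
    using that by (auto simp: dim_faces_def)
  obtain q where q: "slice e a b = {q}" "q extreme_point_of ?Q"
    using edge_slice_point[OF assms(1) ab e] by blast
  obtain q' where q': "slice e' a b = {q'}" "q' extreme_point_of ?Q"
    using edge_slice_point[OF assms(1) ab e'] by blast
  have "q \<noteq> q'"
    using slice_mono_iff[OF assms(1) ab, of e e'] slice_mono_iff[OF assms(1) ab, of e' e]
      eP[OF e(1)] eP[OF e'(1)] e(2) e'(2) q(1) q'(1) ne by auto
  then have "closed_segment q q' \<in> dim_faces 1 ?Q" using triangle_sides[OF pQ d c q(2) q'(2)] by blast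
  then obtain F where F: "F face_of P" "v \<in> F" "F \<noteq> {v}" "slice F a b = closed_segment q q'"
    and d1: "aff_dim (closed_segment q q') = 1"
    using face_of_slice_lift[OF assms(1) ab, of "closed_segment q q'"]
    by (auto simp: dim_faces_def)
  have "F \<in> dim_faces 2 P"
    using slice_of_face(3)[OF assms(1) ab F(1-3)] F(1,4) d1 by (simp add: dim_faces_def)
  moreover have "e \<subseteq> F" "e' \<subseteq> F"
    using slice_mono_iff[OF assms(1) ab _ _ _ F(1), of e] slice_mono_iff[OF assms(1) ab _ _ _ F(1), of e']
      e(2) e'(2) eP[OF e(1)] eP[OF e'(1)] F(4) q(1) q'(1) by auto
  ultimately show thesis by (rule that)
qed

section \<open>The corner principle\<close>

lemma dim_faces_subset_eq:
  fixes P :: "'a::euclidean_space set"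
  assumes "e \<in> dim_faces k P" "e' \<in> dim_faces k P" "e \<subseteq> e'"
  shows "e = e'"
proof -
  have e: "e face_of P" "e' face_of P" "aff_dim e = aff_dim e'"
    using assms by (auto simp: dim_faces_def)
  then have "e face_of e'" using assms(3) face_of_face by blast
  then show ?thesis
    using face_of_aff_dim_lt[OF face_of_imp_convex[OF e(2)]] e(3) by fastforce
qed

lemma rel_interior_point_in_one_edge:
  fixes P :: "'a::euclidean_space set"
  assumes "e \<in> dim_faces k P" "e' \<in> dim_faces k P" "z \<in> rel_interior e" "z \<in> e'"
  shows "e = e'"
proof -
  have "e \<subseteq> e'"
    using assms subset_of_face_of[of e' P e] face_of_imp_subset by (auto simp: dim_faces_def)
  then show ?thesis by (rule dim_faces_subset_eq[OF assms(1,2)])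
qed

lemma exists_dual_pair:
  fixes u w :: "'a::euclidean_space"
  assumes "\<not> collinear {0, u, w}"
  obtains A B where "A \<bullet> u = 1" "A \<bullet> w = 0" "B \<bullet> u = 0" "B \<bullet> w = 1"
proof -
  define d where "d = (u \<bullet> u) * (w \<bullet> w) - (u \<bullet> w)\<^sup>2"
  have "\<bar>u \<bullet> w\<bar> \<noteq> norm u * norm w" using assms norm_cauchy_schwarz_equal by blast
  then have "\<bar>u \<bullet> w\<bar>\<^sup>2 \<noteq> (norm u * norm w)\<^sup>2"
    using power2_eq_imp_eq[of "\<bar>u \<bullet> w\<bar>" "norm u * norm w"] by auto
  then have "d \<noteq> 0" by (simp add: d_def power_mult_distrib dot_square_norm)
  define U W where "U = (w \<bullet> w) *\<^sub>R u - (u \<bullet> w) *\<^sub>R w" and "W = (u \<bullet> u) *\<^sub>R w - (u \<bullet> w) *\<^sub>R u"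
  have "U \<bullet> u = d" "U \<bullet> w = 0" "W \<bullet> u = 0" "W \<bullet> w = d"
    by (simp_all add: U_def W_def d_def inner_diff_left inner_commute[of w u] power2_eq_square)
  with \<open>d \<noteq> 0\<close> show thesis by (intro that[of "(1 / d) *\<^sub>R U" "(1 / d) *\<^sub>R W"]) simp_all
qed

text \<open>Affine coordinates of the plane of a polygon \<open>F\<close> adapted to its corner \<open>v\<close>: the functionals \<open>A\<close> and \<open>B\<close>
are dual to the vectors from \<open>v\<close> to its two neighbours \<open>a\<close> and \<open>b\<close>, and \<open>F\<close> lies in the quadrant spanned by these vectors.\<close>

definition corner_frame where
  "corner_frame F v a b A B \<longleftrightarrow> a extreme_point_of F \<and> b extreme_point_of F \<and>
     A \<bullet> (a - v) = 1 \<and> A \<bullet> (b - v) = 0 \<and> B \<bullet> (a - v) = 0 \<and> B \<bullet> (b - v) = 1 \<and>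
     (\<forall>z\<in>F. 0 \<le> A \<bullet> (z - v) \<and> 0 \<le> B \<bullet> (z - v) \<and>
        z = v + (A \<bullet> (z - v)) *\<^sub>R (a - v) + (B \<bullet> (z - v)) *\<^sub>R (b - v))"

lemma corner_coordinates:
  fixes F :: "'a::euclidean_space set"
  assumes F: "polytope F" "aff_dim F = 2" and e: "e \<in> dim_faces 1 F" "e' \<in> dim_faces 1 F" "e \<noteq> e'"
    and v: "v extreme_point_of F" "v \<in> e" "v \<in> e'"
  obtains a b A B where "e = closed_segment v a" "e' = closed_segment v b"
    "corner_frame F v a b A B"
proof -
  obtain a where a: "e = closed_segment v a" "a \<noteq> v" "a extreme_point_of F"
    using edge_at_vertex[OF F(1) e(1) v(2,1)] .
  obtain b where b: "e' = closed_segment v b" "b \<noteq> v" "b extreme_point_of F"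
    using edge_at_vertex[OF F(1) e(2) v(3,1)] .
  have sub: "v \<in> F" "a \<in> F" "b \<in> F" using v a b by (auto simp: extreme_point_of_def)
  have nc: "\<not> collinear {v, a, b}"
  proof
    assume "collinear {v, a, b}"
    then have "b \<in> affine hull {v, a}" using a(2) collinear_3_affine_hull by metis
    also have "\<dots> \<subseteq> affine hull e" unfolding a(1) by (intro hull_mono) simp
    finally have "b \<in> affine hull e \<inter> F" using sub by blast
    also have "\<dots> = e"
      using face_of_imp_eq_affine_Int[OF polytope_imp_convex[OF F(1)], of e] e(1) by (simp add: dim_faces_def)
    finally have "e' \<subseteq> e"
      unfolding b(1) using v(2) face_of_imp_convex e(1) by (intro closed_segment_subset) (auto simp: dim_faces_def)
    then show False using dim_faces_subset_eq[OF e(2,1)] e(3) by blast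
  qed
  have "collinear {a, v, b} \<longleftrightarrow> collinear {0, a - v, b - v}" by (rule collinear_3) simp
  then have "\<not> collinear {0, a - v, b - v}" using nc by (simp add: insert_commute)
  then obtain A B where AB: "A \<bullet> (a - v) = 1" "A \<bullet> (b - v) = 0" "B \<bullet> (a - v) = 0" "B \<bullet> (b - v) = 1"
    by (rule exists_dual_pair)
  have "aff_dim F \<le> aff_dim {v, a, b}" using nc F(2) by (simp add: collinear_aff_dim)
  then have "aff_dim {v, a, b} = aff_dim F"
    using aff_dim_subset[of "{v, a, b}" F] sub by simp
  then have "affine hull {v, a, b} = affine hull F"
    using aff_dim_eq_full_gen[of "{v, a, b}" F] sub by simp
  then have coord: "z = v + (A \<bullet> (z - v)) *\<^sub>R (a - v) + (B \<bullet> (z - v)) *\<^sub>R (b - v)" if "z \<in> F" for z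
  proof -
    have "z \<in> affine hull {v, a, b}" using that \<open>affine hull {v, a, b} = affine hull F\<close> hull_inc by metis
    then obtain k l m where klm: "z = k *\<^sub>R v + l *\<^sub>R a + m *\<^sub>R b" "k + l + m = 1"
      unfolding affine_hull_3 by blast
    then have k: "k = 1 - l - m" by simp
    then have z: "z - v = l *\<^sub>R (a - v) + m *\<^sub>R (b - v)" unfolding klm(1) k by (simp add: algebra_simps)
    then have lm: "A \<bullet> (z - v) = l" "B \<bullet> (z - v) = m" using AB by (simp_all add: inner_add_right)
    have "z = v + (z - v)" by simp
    then show ?thesis unfolding lm using z by (simp only: add.assoc)
  qed
  have "e \<in> {e \<in> dim_faces 1 F. v \<in> e}" "e' \<in> {e \<in> dim_faces 1 F. v \<in> e}" using e v by simp_all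
  then have two: "{e \<in> dim_faces 1 F. v \<in> e} = {e, e'}"
    using card_edges_at_polygon_vertex[OF F v(1)] e(3) finite_dim_faces[OF F(1), of 1]
    by (intro card_subset_eq[symmetric]) auto
  have nonneg: "0 \<le> C \<bullet> (z - v)" if "z \<in> F" "0 \<le> C \<bullet> (a - v)" "0 \<le> C \<bullet> (b - v)" for C z
  proof -
    have "(- C) \<bullet> z \<le> (- C) \<bullet> v"
    proof (rule vertex_max_if_max_on_edges[OF F(1) v(1) _ that(1)])
      fix f y assume "f \<in> dim_faces 1 F" "v \<in> f" "y \<in> f"
      then have "y \<in> closed_segment v a \<or> y \<in> closed_segment v b" using two a(1) b(1) by blast
      then obtain t d where t: "0 \<le> t" "d = a \<or> d = b" "y = (1 - t) *\<^sub>R v + t *\<^sub>R d"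
        unfolding closed_segment_def by blast
      then have "C \<bullet> y = C \<bullet> v + t * (C \<bullet> (d - v))" unfolding t(3) by (simp add: algebra_simps)
      moreover have "0 \<le> t * (C \<bullet> (d - v))" using that t by (intro mult_nonneg_nonneg) auto
      ultimately show "(- C) \<bullet> y \<le> (- C) \<bullet> v" by simp
    qed
    then show ?thesis by (simp add: inner_diff_right)
  qed
  have "corner_frame F v a b A B"
    unfolding corner_frame_def using a(3) b(3) AB nonneg coord by simp
  with a(1) b(1) show thesis by (rule that)
qed

text \<open>A point of the triangle \<open>v\<close>, \<open>a\<close>, \<open>b\<close> that is off the side opposite to \<open>v\<close> is either on one of the edges at \<open>v\<close>
or on an open segment from \<open>v\<close> to an inner point \<open>m\<close> of that side. In the latter case a face containing it
contains \<open>v\<close>, then \<open>m\<close>, then \<open>a\<close> and \<open>b\<close>, which is too much for an edge.\<close>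

lemma corner_triangle_contains_no_inner_edge_point:
  fixes F :: "'a::euclidean_space set"
  assumes F: "polytope F" and e: "closed_segment v a \<in> dim_faces 1 F" "closed_segment v b \<in> dim_faces 1 F"
      "closed_segment v a \<noteq> closed_segment v b"
    and f: "f \<in> dim_faces 1 F" "z \<in> rel_interior f" "f \<noteq> closed_segment v a" "f \<noteq> closed_segment v b"
    and z: "z = v + s *\<^sub>R (a - v) + t *\<^sub>R (b - v)" "0 \<le> s" "0 \<le> t"
  shows "1 \<le> s + t"
proof (rule ccontr)
  assume lt: "\<not> 1 \<le> s + t"
  have zf: "z \<in> f" using f(2) rel_interior_subset by blast
  have notin: "z \<notin> closed_segment v a" "z \<notin> closed_segment v b"
    using rel_interior_point_in_one_edge[OF f(1) e(1) f(2)] rel_interior_point_in_one_edge[OF f(1) e(2) f(2)]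
      f(3,4) by blast+
  have "t \<noteq> 0"
  proof
    assume "t = 0"
    then have "z = (1 - s) *\<^sub>R v + s *\<^sub>R a" using z(1) by (simp add: algebra_simps)
    then show False using notin(1) z lt unfolding closed_segment_def by auto
  qed
  have "s \<noteq> 0"
  proof
    assume "s = 0"
    then have "z = (1 - t) *\<^sub>R v + t *\<^sub>R b" using z(1) by (simp add: algebra_simps)
    then show False using notin(2) z lt unfolding closed_segment_def by auto
  qed
  have st: "0 < s" "0 < t" "s + t < 1" using z lt \<open>s \<noteq> 0\<close> \<open>t \<noteq> 0\<close> by simp_all
  have sub: "closed_segment v a \<subseteq> F" "closed_segment v b \<subseteq> F"
    using e face_of_imp_subset by (auto simp: dim_faces_def)
  then have vab: "v \<in> F" "a \<in> F" "b \<in> F" using ends_in_segment by blast+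
  have ff: "f face_of F" using f(1) by (simp add: dim_faces_def)
  have ne: "a \<noteq> b" using e(3) by blast
  define m where "m = (1 - t / (s + t)) *\<^sub>R a + (t / (s + t)) *\<^sub>R b"
  have m: "m \<in> open_segment a b"
    unfolding in_segment m_def using st ne by (auto intro!: exI[of _ "t / (s + t)"])
  then have mF: "m \<in> F"
    using closed_segment_subset[OF vab(2,3) polytope_imp_convex[OF F]] open_closed_segment by blast
  have "1 - t / (s + t) = s / (s + t)" using st by (simp add: field_simps)
  then have "(s + t) *\<^sub>R m = s *\<^sub>R a + t *\<^sub>R b" using st by (simp add: m_def scaleR_add_right)
  then have zm: "z = (1 - (s + t)) *\<^sub>R v + (s + t) *\<^sub>R m" using z(1) by (simp add: algebra_simps)
  have "v \<noteq> z" using notin by auto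
  then have "v \<noteq> m" using zm by (auto simp: algebra_simps)
  then have "z \<in> open_segment v m"
    unfolding in_segment using st zm by (auto intro!: exI[of _ "s + t"])
  then have "v \<in> f" "m \<in> f" using face_ofD[OF ff _ vab(1) mF zf] by blast+
  moreover have "a \<in> f" using face_ofD[OF ff m vab(2,3)] \<open>m \<in> f\<close> by blast
  ultimately have "closed_segment v a \<subseteq> f"
    using face_of_imp_convex[OF ff] by (intro closed_segment_subset)
  then show False using dim_faces_subset_eq[OF e(1) f(1)] f(3) by blast
qed

text \<open>What remains of the two inscription conditions when only the points \<open>x\<close> chosen on the edges of \<open>P\<close> and the
set \<open>G\<close> of vertices of the innermost graph are kept. The map \<open>y\<close> picks the point of \<open>G\<close> on each side of the polygons.\<close>

definition circumscribes :: "'a::euclidean_space set \<Rightarrow> 'a set \<Rightarrow> ('a set \<Rightarrow> 'a) \<Rightarrow> bool" where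
  "circumscribes P G x \<longleftrightarrow> (\<forall>e\<in>dim_faces 1 P. x e \<in> rel_interior e) \<and>
     (\<exists>y. (\<forall>s\<in>(\<Union>F\<in>dim_faces 2 P. joined_points (skeleton P) F x). y s \<in> rel_interior s) \<and>
          G = y ` (\<Union>F\<in>dim_faces 2 P. joined_points (skeleton P) F x))"

lemma edges_skeleton: "edges (skeleton P) = dim_faces 1 P"
  by (auto simp: skeleton_def dim_faces_def edge_of_def)

lemma joined_points_eq:
  "joined_points (skeleton P) F x = {closed_segment (x e) (x e') | e e'. e \<in> dim_faces 1 P \<and> e \<subseteq> F \<and>
     e' \<in> dim_faces 1 P \<and> e' \<subseteq> F \<and> e \<noteq> e' \<and> e \<inter> e' \<noteq> {}}"
  unfolding joined_points_def edges_on_def edges_skeleton by blast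

lemma inner_points_distinct:
  assumes "circumscribes P G x" "e \<in> dim_faces 1 P" "e' \<in> dim_faces 1 P" "e \<noteq> e'"
  shows "x e \<noteq> x e'"
proof -
  have "x e \<in> rel_interior e" "x e' \<in> e'"
    using assms rel_interior_subset unfolding circumscribes_def by blast+
  then show ?thesis using rel_interior_point_in_one_edge assms(2-4) by metis
qed

lemma inner_point_on_edge:
  assumes "circumscribes P G x" "closed_segment v a \<in> dim_faces 1 P"
  obtains t where "0 < t" "t < 1" "x (closed_segment v a) = v + t *\<^sub>R (a - v)"
proof -
  have ne: "v \<noteq> a" using assms(2) by (auto simp: dim_faces_def)
  have "x (closed_segment v a) \<in> rel_interior (closed_segment v a)"
    using assms by (simp add: circumscribes_def)
  then have "x (closed_segment v a) \<in> open_segment v a"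
    using ne by (simp add: rel_interior_closed_segment)
  then obtain t where "0 < t" "t < 1" "x (closed_segment v a) = (1 - t) *\<^sub>R v + t *\<^sub>R a"
    unfolding in_segment by blast
  then show thesis using that[of t] by (simp add: algebra_simps)
qed

text \<open>The points of \<open>G\<close> in the facet \<open>F\<close> come from the polygon in \<open>F\<close> itself: a point of \<open>F\<close> inside the segment
joining \<open>x e\<close> and \<open>x e'\<close> forces both of these into the face \<open>F\<close>, and with them the edges \<open>e\<close> and \<open>e'\<close>, in
whose relative interiors they lie.\<close>

lemma inscribed_points_on_face:
  fixes P :: "'a::euclidean_space set"
  assumes x: "circumscribes P G x" and F: "F \<in> dim_faces 2 P"
  obtains y where "\<forall>s\<in>joined_points (skeleton P) F x. y s \<in> rel_interior s"
    "G \<inter> F = y ` joined_points (skeleton P) F x"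
proof -
  obtain y where y: "\<forall>s\<in>(\<Union>F\<in>dim_faces 2 P. joined_points (skeleton P) F x). y s \<in> rel_interior s"
    "G = y ` (\<Union>F\<in>dim_faces 2 P. joined_points (skeleton P) F x)"
    using x unfolding circumscribes_def by blast
  have FP: "F face_of P" using F by (simp add: dim_faces_def)
  have "G \<inter> F = y ` joined_points (skeleton P) F x"
  proof
    show "y ` joined_points (skeleton P) F x \<subseteq> G \<inter> F"
    proof clarify
      fix s assume s: "s \<in> joined_points (skeleton P) F x"
      then obtain e e' where e: "e \<in> dim_faces 1 P" "e \<subseteq> F" "e' \<in> dim_faces 1 P" "e' \<subseteq> F"
        "s = closed_segment (x e) (x e')"
        unfolding joined_points_eq by blast
      then have "x e \<in> F" "x e' \<in> F"
        using x rel_interior_subset unfolding circumscribes_def by blast+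
      then have "s \<subseteq> F" using closed_segment_subset face_of_imp_convex[OF FP] e(5) by blast
      moreover have "y s \<in> s" using y(1) s F rel_interior_subset by blast
      ultimately show "y s \<in> G \<inter> F" using y(2) s F by blast
    qed
    show "G \<inter> F \<subseteq> y ` joined_points (skeleton P) F x"
    proof
      fix g assume g: "g \<in> G \<inter> F"
      then obtain s F' where s: "F' \<in> dim_faces 2 P" "s \<in> joined_points (skeleton P) F' x" "g = y s"
        using y(2) by blast
      then obtain e e' where e: "e \<in> dim_faces 1 P" "e' \<in> dim_faces 1 P" "e \<noteq> e'" "e \<inter> e' \<noteq> {}"
        "s = closed_segment (x e) (x e')"
        unfolding joined_points_eq by blast
      have "g \<in> rel_interior s" using y s by blast
      then have gs: "g \<in> open_segment (x e) (x e')"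
        using inner_points_distinct[OF x e(1-3)] by (simp add: e(5) rel_interior_closed_segment)
      have xe: "x e \<in> rel_interior e" "x e' \<in> rel_interior e'" and sub: "e \<subseteq> P" "e' \<subseteq> P"
        using x e face_of_imp_subset by (auto simp: circumscribes_def dim_faces_def)
      then have "x e \<in> P" "x e' \<in> P" using rel_interior_subset by blast+
      then have "x e \<in> F" "x e' \<in> F" using face_ofD[OF FP gs] g by blast+
      then have "e \<subseteq> F" "e' \<subseteq> F" using subset_of_face_of[OF FP] sub xe by blast+
      then have "s \<in> joined_points (skeleton P) F x" unfolding joined_points_eq using e by blast
      then show "g \<in> y ` joined_points (skeleton P) F x" using s(3) by blast
    qed
  qed
  then show thesis using that y(1) F by blast
qed

lemma inscribed_point_on_face:
  fixes P :: "'a::euclidean_space set"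
  assumes x: "circumscribes P G x" and F: "F \<in> dim_faces 2 P" and g: "g \<in> G" "g \<in> F"
  obtains e e' where "e \<in> dim_faces 1 P" "e \<subseteq> F" "e' \<in> dim_faces 1 P" "e' \<subseteq> F"
    "g \<in> open_segment (x e) (x e')"
proof -
  obtain y where y: "\<forall>s\<in>joined_points (skeleton P) F x. y s \<in> rel_interior s"
    "G \<inter> F = y ` joined_points (skeleton P) F x"
    using inscribed_points_on_face[OF x F] .
  then obtain s where s: "s \<in> joined_points (skeleton P) F x" "g = y s" using g by blast
  then obtain e e' where e: "e \<in> dim_faces 1 P" "e \<subseteq> F" "e' \<in> dim_faces 1 P" "e' \<subseteq> F" "e \<noteq> e'"
    "s = closed_segment (x e) (x e')"
    unfolding joined_points_eq by blast
  then have "g \<in> open_segment (x e) (x e')"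
    using y(1)[rule_format, OF s(1)] s(2) inner_points_distinct[OF x e(1,3,5)] by (simp add: rel_interior_closed_segment)
  then show thesis using that e by blast
qed

lemma corner_side_point:
  fixes P :: "'a::euclidean_space set"
  assumes x: "circumscribes P G x" and F: "F \<in> dim_faces 2 P"
    and e: "e \<in> dim_faces 1 P" "e' \<in> dim_faces 1 P" "e \<subseteq> F" "e' \<subseteq> F" "e \<noteq> e'" "e \<inter> e' \<noteq> {}"
  obtains g where "g \<in> G" "g \<in> F" "g \<in> open_segment (x e) (x e')"
proof -
  obtain y where y: "\<forall>s\<in>joined_points (skeleton P) F x. y s \<in> rel_interior s"
    "G \<inter> F = y ` joined_points (skeleton P) F x"
    using inscribed_points_on_face[OF x F] .
  let ?s = "closed_segment (x e) (x e')"
  have s: "?s \<in> joined_points (skeleton P) F x" unfolding joined_points_eq using e by blast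
  then have "y ?s \<in> G" "y ?s \<in> F" using y(2) by blast+
  moreover have "y ?s \<in> open_segment (x e) (x e')"
    using y(1)[rule_format, OF s] inner_points_distinct[OF x e(1,2,5)] by (simp add: rel_interior_closed_segment)
  ultimately show thesis by (rule that)
qed

text \<open>The key fact. If the points of \<open>x'\<close> on the two edges of a corner were both at least as near to \<open>v\<close> as
those of \<open>x\<close>, one of them strictly, then the inner points of the side joining them would lie strictly on the side of \<open>v\<close> of the
line through \<open>x e\<close> and \<open>x e'\<close>. One of these inner points belongs to \<open>G\<close>. But the points of \<open>G\<close> in \<open>F\<close> lie on the polygon
of \<open>x\<close>, which is on the far side of that line. So in every corner one point moves towards \<open>v\<close> and the other
one away from it, or both stay.\<close>

lemma corner_rigid:
  fixes P :: "'a::euclidean_space set"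
  assumes P: "polytope P" and x: "circumscribes P G x" and x': "circumscribes P G x'"
    and F: "F \<in> dim_faces 2 P"
    and e: "e \<in> dim_faces 1 P" "e' \<in> dim_faces 1 P" "e \<subseteq> F" "e' \<subseteq> F" "e \<noteq> e'"
    and v: "v extreme_point_of P" "v \<in> e" "v \<in> e'"
    and near: "x' e \<in> closed_segment v (x e)" "x' e' \<in> closed_segment v (x e')"
  shows "x' e = x e \<and> x' e' = x e'"
proof -
  have FP: "F face_of P" "aff_dim F = 2" using F by (auto simp: dim_faces_def)
  have pF: "polytope F" using FP P face_of_polytope_polytope by blast
  have eF: "e \<in> dim_faces 1 F" "e' \<in> dim_faces 1 F" using e dim_faces_of_face[OF FP(1)] by auto
  have vF: "v extreme_point_of F" using v e(3) extreme_point_of_face[OF FP(1)] by blast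
  obtain a b A B where ab: "e = closed_segment v a" "e' = closed_segment v b" "corner_frame F v a b A B"
    using corner_coordinates[OF pF FP(2) eF e(5) vF v(2,3)] .
  then have AB: "A \<bullet> (a - v) = 1" "A \<bullet> (b - v) = 0" "B \<bullet> (a - v) = 0" "B \<bullet> (b - v) = 1"
    "\<And>z. z \<in> F \<Longrightarrow> z = v + (A \<bullet> (z - v)) *\<^sub>R (a - v) + (B \<bullet> (z - v)) *\<^sub>R (b - v)"
    "\<And>z. z \<in> F \<Longrightarrow> 0 \<le> A \<bullet> (z - v)" "\<And>z. z \<in> F \<Longrightarrow> 0 \<le> B \<bullet> (z - v)"
    unfolding corner_frame_def by blast+
  obtain t where t: "0 < t" "t < 1" "x e = v + t *\<^sub>R (a - v)"
    using inner_point_on_edge[OF x] e(1) unfolding ab(1) by blast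
  obtain s where s: "0 < s" "s < 1" "x e' = v + s *\<^sub>R (b - v)"
    using inner_point_on_edge[OF x] e(2) unfolding ab(2) by blast
  obtain k where k: "0 \<le> k" "k \<le> 1" "x' e = (1 - k) *\<^sub>R v + k *\<^sub>R x e"
    using near(1) unfolding closed_segment_def by blast
  obtain l where l: "0 \<le> l" "l \<le> 1" "x' e' = (1 - l) *\<^sub>R v + l *\<^sub>R x e'"
    using near(2) unfolding closed_segment_def by blast
  \<comment> \<open>the line through x e and x e' is where H takes the value 1 relative to v\<close>
  define H where "H = (1 / t) *\<^sub>R A + (1 / s) *\<^sub>R B"
  have far: "1 \<le> H \<bullet> (x f - v)" if f: "f \<in> dim_faces 1 P" "f \<subseteq> F" for f
  proof (cases "f = e \<or> f = e'")
    case True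
    then show ?thesis using t s AB(1-4) by (auto simp: H_def inner_add_left)
  next
    case False
    have fF: "f \<in> dim_faces 1 F" using f dim_faces_of_face[OF FP(1)] by auto
    have xf: "x f \<in> rel_interior f" using x f by (simp add: circumscribes_def)
    then have xF: "x f \<in> F" using f(2) rel_interior_subset by blast
    have "1 \<le> A \<bullet> (x f - v) + B \<bullet> (x f - v)"
      by (rule corner_triangle_contains_no_inner_edge_point[OF pF eF[unfolded ab(1,2)] e(5)[unfolded ab(1,2)]
            fF xf _ _ AB(5)[OF xF] AB(6)[OF xF] AB(7)[OF xF]]) (use False ab(1,2) in auto)
    also have "\<dots> \<le> (A \<bullet> (x f - v)) / t + (B \<bullet> (x f - v)) / s"
      using t s AB(6,7)[OF xF] by (intro add_mono) (simp_all add: le_divide_eq mult_left_le)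
    also have "\<dots> = H \<bullet> (x f - v)" by (simp add: H_def inner_add_left)
    finally show ?thesis .
  qed
  have "e \<inter> e' \<noteq> {}" using v by blast
  then obtain g where g: "g \<in> G" "g \<in> F" "g \<in> open_segment (x' e) (x' e')"
    using corner_side_point[OF x' F e] by blast
  obtain f f' where f: "f \<in> dim_faces 1 P" "f \<subseteq> F" "f' \<in> dim_faces 1 P" "f' \<subseteq> F"
    "g \<in> open_segment (x f) (x f')"
    using inscribed_point_on_face[OF x F g(1,2)] by metis
  obtain p where p: "0 < p" "p < 1" "g = (1 - p) *\<^sub>R x f + p *\<^sub>R x f'"
    using f(5) unfolding in_segment by blast
  have "g - v = (1 - p) *\<^sub>R (x f - v) + p *\<^sub>R (x f' - v)" unfolding p(3) by (simp add: algebra_simps)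
  then have "H \<bullet> (g - v) = (1 - p) * (H \<bullet> (x f - v)) + p * (H \<bullet> (x f' - v))" by (simp add: inner_add_right)
  moreover have "(1 - p) * 1 \<le> (1 - p) * (H \<bullet> (x f - v))" "p * 1 \<le> p * (H \<bullet> (x f' - v))"
    using p far[OF f(1,2)] far[OF f(3,4)] by (intro mult_left_mono; simp)+
  ultimately have ge: "1 \<le> H \<bullet> (g - v)" by simp
  obtain q where q: "0 < q" "q < 1" "g = (1 - q) *\<^sub>R x' e + q *\<^sub>R x' e'"
    using g(3) unfolding in_segment by blast
  have "x' e - v = k *\<^sub>R (x e - v)" "x' e' - v = l *\<^sub>R (x e' - v)"
    unfolding k(3) l(3) by (simp_all add: algebra_simps)
  moreover have "g - v = (1 - q) *\<^sub>R (x' e - v) + q *\<^sub>R (x' e' - v)" unfolding q(3) by (simp add: algebra_simps)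
  ultimately have "H \<bullet> (g - v) = (1 - q) * (k * (H \<bullet> (x e - v))) + q * (l * (H \<bullet> (x e' - v)))"
    by (simp add: inner_add_right)
  moreover have "H \<bullet> (x e - v) = 1" "H \<bullet> (x e' - v) = 1"
    using t s AB(1-4) by (simp_all add: H_def inner_add_left)
  ultimately have "1 \<le> (1 - q) * k + q * l" using ge by simp
  then have "(1 - q) * (1 - k) + q * (1 - l) \<le> 0" by (simp add: algebra_simps)
  moreover have "0 \<le> (1 - q) * (1 - k)" "0 \<le> q * (1 - l)" using q k l by simp_all
  ultimately have "(1 - q) * (1 - k) = 0" "q * (1 - l) = 0" by linarith+
  then have "k = 1" "l = 1" using q by simp_all
  then show ?thesis using k(3) l(3) by simp
qed

lemma nearer_on_ray:
  fixes v d :: "'a::euclidean_space"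
  assumes "0 < q" "q \<le> p"
  shows "v + q *\<^sub>R d \<in> closed_segment v (v + p *\<^sub>R d)"
  unfolding in_segment using assms by (intro exI[of _ "q / p"]) (simp add: algebra_simps)

lemma nearer_total:
  fixes P :: "'a::euclidean_space set"
  assumes "polytope P" "circumscribes P G x" "circumscribes P G x'" "e \<in> dim_faces 1 P"
    "v extreme_point_of P" "v \<in> e"
  shows "x' e \<in> closed_segment v (x e) \<or> x e \<in> closed_segment v (x' e)"
proof -
  obtain a where a: "e = closed_segment v a"
    using edge_at_vertex[OF assms(1,4,6,5)] by blast
  obtain t where t: "0 < t" "x e = v + t *\<^sub>R (a - v)"
    using inner_point_on_edge[OF assms(2)] assms(4) unfolding a by blast
  obtain s where s: "0 < s" "x' e = v + s *\<^sub>R (a - v)"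
    using inner_point_on_edge[OF assms(3)] assms(4) unfolding a by blast
  show ?thesis
    using nearer_on_ray[OF s(1), of t v "a - v"] nearer_on_ray[OF t(1), of s v "a - v"] s t
    by (metis linear)
qed

text \<open>In a corner where one of the two points stays, the other one moves neither towards the corner nor
away from it. Hence agreement passes from edge to edge.\<close>

lemma agree_everywhere:
  fixes P :: "'a::euclidean_space set"
  assumes "polytope P" "circumscribes P G x" "circumscribes P G x'" "e \<in> dim_faces 1 P" "x' e = x e"
    and "f \<in> dim_faces 1 P"
  shows "x' f = x f"
proof -
  let ?M = "{e \<in> dim_faces 1 P. x' e = x e}"
  have "?M = dim_faces 1 P"
  proof (rule edges_connected[OF assms(1)])
    fix F e e' v
    assume F: "F \<in> dim_faces 2 P" and e: "e \<in> ?M" "e' \<in> dim_faces 1 P" "e \<subseteq> F" "e' \<subseteq> F"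
      and v: "v extreme_point_of P" "v \<in> e" "v \<in> e'"
    have "x' e' = x e'"
    proof (cases "e = e'")
      case False
      have e1: "e \<in> dim_faces 1 P" "x' e \<in> closed_segment v (x e)" "x e \<in> closed_segment v (x' e)"
        using e(1) by auto
      from nearer_total[OF assms(1-3) e(2) v(1,3)] show ?thesis
      proof
        assume "x' e' \<in> closed_segment v (x e')"
        then show ?thesis
          using corner_rigid[OF assms(1-3) F e1(1) e(2-4) False v e1(2)] by blast
      next
        assume "x e' \<in> closed_segment v (x' e')"
        then show ?thesis
          using corner_rigid[OF assms(1,3,2) F e1(1) e(2-4) False v e1(3)] by simp
      qed
    qed (use e(1) in simp)
    then show "e' \<in> ?M" using e(2) by simp
  qed (use assms(4,5) in auto)
  then show ?thesis using assms(6) by blast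
qed

text \<open>Of three edges at \<open>v\<close>, two carry points that move in the same direction relative to \<open>v\<close>; these two
edges share a facet, so nothing moves.\<close>

lemma agree_if_trivalent_vertex:
  fixes P :: "'a::euclidean_space set"
  assumes "polytope P" "aff_dim P = 3" "circumscribes P G x" "circumscribes P G x'"
    and v: "v extreme_point_of P" "card {e \<in> dim_faces 1 P. v \<in> e} = 3" and "f \<in> dim_faces 1 P"
  shows "x' f = x f"
proof -
  obtain e1 e2 e3 where e: "{e \<in> dim_faces 1 P. v \<in> e} = {e1, e2, e3}" "e1 \<noteq> e2" "e2 \<noteq> e3" "e1 \<noteq> e3"
    using v(2) by (metis card_3_iff)
  have ei: "e1 \<in> dim_faces 1 P" "v \<in> e1" "e2 \<in> dim_faces 1 P" "v \<in> e2" "e3 \<in> dim_faces 1 P" "v \<in> e3"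
    using e(1) by blast+
  have agree: "x' f = x f" if e: "e \<in> dim_faces 1 P" "v \<in> e" "e' \<in> dim_faces 1 P" "v \<in> e'" "e \<noteq> e'"
    and near: "x' e \<in> closed_segment v (x e) \<and> x' e' \<in> closed_segment v (x e') \<or>
      x e \<in> closed_segment v (x' e) \<and> x e' \<in> closed_segment v (x' e')" for e e'
  proof -
    obtain F where F: "F \<in> dim_faces 2 P" "e \<subseteq> F" "e' \<subseteq> F"
      using trivalent_vertex_facets[OF assms(1,2) v e] .
    have "x' e = x e"
      using corner_rigid[OF assms(1,3,4) F(1) e(1,3) F(2,3) e(5) v(1) e(2,4)]
        corner_rigid[OF assms(1,4,3) F(1) e(1,3) F(2,3) e(5) v(1) e(2,4)] near by auto
    then show ?thesis using agree_everywhere[OF assms(1,3,4) e(1) _ assms(7)] by blast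
  qed
  show ?thesis
    using nearer_total[OF assms(1,3,4) ei(1) v(1) ei(2)] nearer_total[OF assms(1,3,4) ei(3) v(1) ei(4)]
      nearer_total[OF assms(1,3,4) ei(5) v(1) ei(6)]
      agree[OF ei(1-4) e(2)] agree[OF ei(3-6) e(3)] agree[OF ei(1,2,5,6) e(4)] by blast
qed

section \<open>Triangles inscribed into a triangle\<close>

text \<open>A triangle with vertices \<open>t\<close>, \<open>s\<close>, \<open>m\<close> of the way along the sides \<open>v a\<close>, \<open>a b\<close>, \<open>b v\<close> of a fixed triangle
\<open>v\<close>, \<open>a\<close>, \<open>b\<close> is given by its parameters \<open>(t, s, m)\<close>. Points of the plane are given by barycentric coordinates with respect
to \<open>v\<close>, \<open>a\<close>, \<open>b\<close>; the vertices of the inscribed triangle are \<open>(1 - t, t, 0)\<close>, \<open>(0, 1 - s, s)\<close> and \<open>(m, 0, 1 - m)\<close>.\<close>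

type_synonym triple = "real \<times> real \<times> real"

text \<open>The cyclic relabelling \<open>v \<rightarrow> a \<rightarrow> b \<rightarrow> v\<close> acts in the same way on parameters and on barycentric coordinates, so that
statements on the side cutting off \<open>a\<close> carry over to the two other sides.\<close>

definition rot :: "triple \<Rightarrow> triple" where
  "rot = (\<lambda>(a, b, c). (b, c, a))"

lemma rot_simp [simp]: "rot (a, b, c) = (b, c, a)"
  by (simp add: rot_def)

lemma rot_rot_rot [simp]: "rot (rot (rot z)) = z"
  by (cases z) simp

text \<open>The point \<open>g\<close> is inside the side joining \<open>(1 - t, t, 0)\<close> and \<open>(0, 1 - s, s)\<close>, which cuts off the corner \<open>a\<close>.\<close>

definition on_side :: "triple \<Rightarrow> triple \<Rightarrow> bool" where
  "on_side = (\<lambda>(t, s, m) g.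
     \<exists>l. 0 < l \<and> l < 1 \<and> g = ((1 - l) * (1 - t), (1 - l) * t + l * (1 - s), l * s))"

definition in_cube :: "triple \<Rightarrow> bool" where
  "in_cube = (\<lambda>(t, s, m). 0 < t \<and> t < 1 \<and> 0 < s \<and> s < 1 \<and> 0 < m \<and> m < 1)"

lemma in_cube_rot [simp]: "in_cube (rot z) = in_cube z"
  by (cases z) (auto simp: in_cube_def)

text \<open>When the parameter on the side \<open>v a\<close> grows from \<open>t\<close> to \<open>t'\<close>, the new side cutting off \<open>a\<close> lies beyond the
line through the old side cutting off \<open>v\<close>: the functional of that line is at least 1 at its first end and exceeds 1 at its second end.\<close>

lemma on_side_disjoint:
  assumes "on_side z' g" "on_side (rot (rot z)) (rot (rot g))" "in_cube z" "in_cube z'" "fst z \<le> fst z'"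
  shows False
proof -
  obtain t s m where z: "z = (t, s, m)" by (cases z)
  obtain t' s' m' where z': "z' = (t', s', m')" by (cases z')
  obtain a b c where g: "g = (a, b, c)" by (cases g)
  have I: "0 < t" "t < 1" "t \<le> t'" "0 < s'" "s' < 1" "0 < m" "m < 1"
    using assms(3-5) by (simp_all add: z z' in_cube_def)
  obtain l where l: "0 < l" "l < 1" "b = (1 - l) * t' + l * (1 - s')" "c = l * s'"
    using assms(1) by (auto simp: on_side_def g z')
  obtain k where k: "c = (1 - k) * (1 - m)" "b = k * t"
    using assms(2) by (auto simp: on_side_def g z)
  have "b * (1 - m) + c * t = t * (1 - m)" unfolding k by (simp add: algebra_simps)
  moreover have "b * (1 - m) + c * t = (1 - l) * (t' * (1 - m)) + l * ((1 - s') * (1 - m) + s' * t)"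
    unfolding l(3,4) by (simp add: algebra_simps)
  moreover have "(1 - l) * (t * (1 - m)) \<le> (1 - l) * (t' * (1 - m))"
    using l I by (intro mult_left_mono mult_right_mono) auto
  moreover have "l * (t * (1 - m)) < l * ((1 - s') * (1 - m) + s' * t)"
  proof (rule mult_strict_left_mono[OF _ l(1)])
    have "(1 - s') * (t * (1 - m)) < (1 - s') * (1 * (1 - m))"
      using I by (intro mult_strict_left_mono mult_strict_right_mono) simp_all
    moreover have "s' * (t * (1 - m)) < s' * (t * 1)"
      using I by (intro mult_strict_left_mono) simp_all
    ultimately show "t * (1 - m) < (1 - s') * (1 - m) + s' * t" by (simp add: algebra_simps)
  qed
  ultimately show False by (simp add: algebra_simps)
qed

text \<open>The points \<open>g\<close>, \<open>h\<close>, \<open>k\<close> are inside the sides cutting off \<open>a\<close>, \<open>b\<close>, \<open>v\<close>.\<close>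

definition fits :: "triple \<Rightarrow> triple \<Rightarrow> triple \<Rightarrow> triple \<Rightarrow> bool" where
  "fits z g h k \<longleftrightarrow> on_side z g \<and> on_side (rot z) (rot h) \<and> on_side (rot (rot z)) (rot (rot k))"

definition less3 :: "triple \<Rightarrow> triple \<Rightarrow> bool" where
  "less3 = (\<lambda>(t, s, m) (t', s', m'). t < t' \<and> s < s' \<and> m < m')"

text \<open>When the inscribed triangle turns forward from \<open>z\<close> to \<open>z'\<close>, the side cutting off \<open>a\<close> stays clear of the old
side cutting off \<open>v\<close>, and cyclically. Three common points thus either all keep their sides, or all pass to the preceding
side.\<close>

lemma fits_shift:
  assumes fz: "fits z g h k" and fz': "fits z' g' h' k'" and c: "in_cube z" "in_cube z'"
    and le: "z = z' \<or> less3 z z'" and eq: "{g', h', k'} = {g, h, k}"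
  shows "(g', h', k') = (g, h, k) \<or> (g', h', k') = (h, k, g)"
proof -
  have dist: "g1 \<noteq> k2 \<and> h1 \<noteq> g2 \<and> k1 \<noteq> h2"
    if "fits z1 g1 h1 k1" "fits z2 g2 h2 k2" "in_cube z1" "in_cube z2" "z2 = z1 \<or> less3 z2 z1"
    for z1 z2 g1 h1 k1 g2 h2 k2
  proof -
    have "fst z2 \<le> fst z1" "fst (rot z2) \<le> fst (rot z1)" "fst (rot (rot z2)) \<le> fst (rot (rot z1))"
      using that(5) by (cases z1; cases z2; auto simp: less3_def)+
    then show ?thesis
      using that on_side_disjoint[of z1 g1 z2] on_side_disjoint[of "rot z1" "rot h1" "rot z2"]
        on_side_disjoint[of "rot (rot z1)" "rot (rot k1)" "rot (rot z2)"]
      unfolding fits_def by auto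
  qed
  have "g' \<noteq> k \<and> h' \<noteq> g \<and> k' \<noteq> h" using dist[OF fz' fz c(2,1)] le by auto
  then have "g' = g \<or> g' = h" "h' = h \<or> h' = k" "k' = k \<or> k' = g" using eq by blast+
  moreover have "g \<noteq> k \<and> h \<noteq> g \<and> k \<noteq> h" using dist[OF fz fz c(1,1)] by auto
  moreover have "g' \<noteq> k' \<and> h' \<noteq> g' \<and> k' \<noteq> h'" using dist[OF fz' fz' c(2,2)] by auto
  ultimately show ?thesis by auto
qed

lemma on_side_relation:
  assumes "on_side (t, s, m) (a, b, c)"
  shows "s * (1 - a - t) = (1 - t) * c" "a + b + c = 1"
proof -
  obtain l where l: "a = (1 - l) * (1 - t)" "b = (1 - l) * t + l * (1 - s)" "c = l * s"
    using assms by (auto simp: on_side_def)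
  show "s * (1 - a - t) = (1 - t) * c" "a + b + c = 1"
    unfolding l by (simp_all add: algebra_simps)
qed

text \<open>With prescribed points on prescribed sides, \<open>t\<close> determines \<open>s\<close>, which determines \<open>m\<close>, which has to lead back to
\<open>t\<close>. Each step is a projective map, and the closing condition is a quadratic equation \<open>p\<close> for \<open>t\<close>. Its constant coefficient
vanishes only if the points \<open>g\<close>, \<open>h\<close> and the corner \<open>v\<close> are collinear. This never happens: the vertex of the inscribed triangle on
\<open>a b\<close> is strictly between the directions from \<open>v\<close> to \<open>g\<close> and to \<open>h\<close>.\<close>

lemma card_fits_le_2:
  assumes "\<And>z. z \<in> Z \<Longrightarrow> in_cube z \<and> fits z g h k"
  shows "finite (fst ` Z) \<and> card (fst ` Z) \<le> 2"
proof (cases "Z = {}")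
  case False
  obtain a1 b1 c1 where g: "g = (a1, b1, c1)" by (cases g)
  obtain a2 b2 c2 where h: "h = (a2, b2, c2)" by (cases h)
  obtain a3 b3 c3 where k: "k = (a3, b3, c3)" by (cases k)
  define p where "p = [:(1 - a1 - c1) * a2, (c1 - 1) * a2:] * [:b3, -1:]
     - [:b3, c3 - 1:] * [:(1 - b2) * (1 - a1) - c1, c1 - (1 - b2):]"
  have root: "poly p t = 0" if z: "(t, s, m) \<in> Z" for t s m
  proof -
    have f: "on_side (t, s, m) (a1, b1, c1)" "on_side (s, m, t) (b2, c2, a2)" "on_side (m, t, s) (c3, a3, b3)"
      using assms[OF z] by (auto simp: fits_def g h k)
    \<comment> \<open>clearing the denominator of s = (1 - t) * c1 / D turns m = (1 - s) * a2 / (1 - b2 - s) into m = K / N\<close>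
    define D N K where "D = 1 - a1 - t" and "N = (1 - b2) * D - (1 - t) * c1"
      and "K = (D - (1 - t) * c1) * a2"
    have 1: "s * D = (1 - t) * c1" unfolding D_def by (rule on_side_relation[OF f(1)])
    have 2: "m * (1 - b2 - s) = (1 - s) * a2" by (rule on_side_relation[OF f(2)])
    have "t * (1 - c3 - m) = (1 - m) * b3" by (rule on_side_relation[OF f(3)])
    then have 3: "m * (b3 - t) = b3 - t * (1 - c3)" by (simp add: algebra_simps)
    have N: "N = D * (1 - b2 - s)" unfolding N_def 1[symmetric] by (simp add: algebra_simps)
    have "K = D * ((1 - s) * a2)" unfolding K_def 1[symmetric] by (simp add: algebra_simps)
    then have "K = m * N" unfolding 2[symmetric] N by simp
    then have "K * (b3 - t) = (m * (b3 - t)) * N" by simp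
    then have "K * (b3 - t) = (b3 - t * (1 - c3)) * N" unfolding 3 .
    then show ?thesis by (simp add: p_def K_def N_def D_def algebra_simps)
  qed
  have "poly p 0 \<noteq> 0"
  proof -
    obtain t s m where z: "(t, s, m) \<in> Z" using False by (metis ex_in_conv prod_cases3)
    have c: "0 < t" "t < 1" "0 < s" "s < 1" "0 < m" "m < 1" using assms[OF z] by (auto simp: in_cube_def)
    have f: "on_side (t, s, m) (a1, b1, c1)" "on_side (s, m, t) (b2, c2, a2)" "on_side (m, t, s) (c3, a3, b3)"
      using assms[OF z] by (auto simp: fits_def g h k)
    obtain l where l: "0 < l" "l < 1" "b1 = (1 - l) * t + l * (1 - s)" "c1 = l * s"
      using f(1) by (auto simp: on_side_def)
    obtain q where q: "0 < q" "q < 1" "b2 = (1 - q) * (1 - s)" "c2 = (1 - q) * s + q * (1 - m)"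
      using f(2) by (auto simp: on_side_def)
    obtain r where r: "0 < r" "b3 = r * t"
      using f(3) by (auto simp: on_side_def)
    \<comment> \<open>comparison of c1 / b1, of s / (1 - s) and of c2 / b2, the slopes of the three directions seen from v\<close>
    have "b1 * s - c1 * (1 - s) = (1 - l) * t * s" unfolding l by (simp add: algebra_simps)
    also have "\<dots> > 0" using c l by simp
    finally have 1: "c1 * (1 - s) < b1 * s" by simp
    have "c2 * (1 - s) - b2 * s = q * (1 - m) * (1 - s)" unfolding q by (simp add: algebra_simps)
    also have "\<dots> > 0" using c q by simp
    finally have 2: "b2 * s < c2 * (1 - s)" by simp
    have pos: "0 < b1" "0 < b2" unfolding l q using c l q by (simp_all add: add_pos_pos)
    have "(c1 * b2) * s = c1 * (b2 * s)" by simp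
    also have "\<dots> < c1 * (c2 * (1 - s))" using 2 c l by (intro mult_strict_left_mono) simp_all
    also have "\<dots> = c2 * (c1 * (1 - s))" by simp
    also have "\<dots> \<le> c2 * (b1 * s)" using 1 c q by (intro mult_left_mono) simp_all
    finally have "c1 * b2 < c2 * b1" using c by (simp add: mult.assoc[symmetric])
    moreover have "poly p 0 = b3 * (c1 * b2 - c2 * b1)"
    proof -
      have A: "a1 = 1 - b1 - c1" "a2 = 1 - b2 - c2"
        using on_side_relation(2)[OF f(1)] on_side_relation(2)[OF f(2)] by linarith+
      show ?thesis unfolding p_def A by (simp add: algebra_simps)
    qed
    moreover have "0 < b3" using r c by simp
    ultimately show ?thesis by simp
  qed
  then have "p \<noteq> 0" by auto
  have "degree p \<le> 2"
    unfolding p_def by (intro degree_diff_le order_trans[OF degree_mult_le] add_mono[of _ 1 _ 1, simplified])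
      (simp_all add: degree_pCons_le)
  have sub: "fst ` Z \<subseteq> {t. poly p t = 0}" using root by auto
  have fin: "finite {t. poly p t = 0}" by (rule poly_roots_finite[OF \<open>p \<noteq> 0\<close>])
  show ?thesis
    using finite_subset[OF sub fin] card_mono[OF fin sub] card_poly_roots_bound[OF \<open>p \<noteq> 0\<close>] \<open>degree p \<le> 2\<close>
    by linarith
qed simp

text \<open>By \<open>fits_shift\<close>, compared with the smallest of the inscribed triangles only two
correspondences between the points of \<open>G\<close> and the sides occur, and each of them admits at most two triangles.\<close>

lemma card_fitting_triples_le_4:
  assumes cube: "\<And>z. z \<in> Z \<Longrightarrow> in_cube z"
    and chain: "\<And>z z'. z \<in> Z \<Longrightarrow> z' \<in> Z \<Longrightarrow> z = z' \<or> less3 z z' \<or> less3 z' z"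
    and G: "\<And>z. z \<in> Z \<Longrightarrow> \<exists>g h k. fits z g h k \<and> G = {g, h, k}"
  shows "finite Z \<and> card Z \<le> 4"
proof (rule ccontr)
  assume big: "\<not> (finite Z \<and> card Z \<le> 4)"
  \<comment> \<open>a finite part of Z, so that a smallest element exists\<close>
  have "\<exists>Y\<subseteq>Z. finite Y \<and> card Y = 5"
  proof (cases "finite Z")
    case True
    then have "5 \<le> card Z" using big by simp
    then show ?thesis using obtain_subset_with_card_n by metis
  qed (metis infinite_arbitrarily_large)
  then obtain Y where Y: "Y \<subseteq> Z" "finite Y" "card Y = 5" by blast
  then have "Y \<noteq> {}" by auto
  then obtain z0 where z0: "z0 \<in> Y" "\<And>z. z \<in> Y \<Longrightarrow> fst z0 \<le> fst z"
    using finite_obtains_min[OF Y(2), of fst] by blast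
  obtain g h k where ghk: "fits z0 g h k" "G = {g, h, k}" using G z0(1) Y(1) by blast
  have inj: "inj_on fst Y"
  proof (rule inj_onI)
    fix z z' assume "z \<in> Y" "z' \<in> Y" "fst z = fst z'"
    then show "z = z'" using chain[of z z'] Y(1) by (cases z; cases z') (auto simp: less3_def)
  qed
  have two: "card X \<le> 2" if "X \<subseteq> Y" "\<And>z. z \<in> X \<Longrightarrow> fits z g h k" for X g h k
  proof -
    have "card (fst ` X) \<le> 2" using card_fits_le_2[of X g h k] that cube Y(1) by blast
    then show ?thesis using card_image[OF inj_on_subset[OF inj that(1)]] by simp
  qed
  have "fits z g h k \<or> fits z h k g" if z: "z \<in> Y" for z
  proof -
    obtain g' h' k' where f: "fits z g' h' k'" "G = {g', h', k'}" using G z Y(1) by blast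
    have "z0 = z \<or> less3 z0 z"
      using chain[of z0 z] z z0 Y(1) z0(2)[OF z] by (cases z; cases z0) (auto simp: less3_def)
    then have "(g', h', k') = (g, h, k) \<or> (g', h', k') = (h, k, g)"
      using fits_shift[OF ghk(1) f(1)] cube z z0(1) Y(1) ghk(2) f(2) by blast
    then show ?thesis using f(1) by auto
  qed
  then have "Y = {z \<in> Y. fits z g h k} \<union> {z \<in> Y. fits z h k g}" by blast
  then have "card Y = card ({z \<in> Y. fits z g h k} \<union> {z \<in> Y. fits z h k g})" by (rule arg_cong)
  also have "\<dots> \<le> card {z \<in> Y. fits z g h k} + card {z \<in> Y. fits z h k g}" by (rule card_Un_le)
  also have "\<dots> \<le> 2 + 2" by (intro add_mono two) auto
  finally show False using Y(3) by simp
qed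

section \<open>Counting the circumscribed graphs\<close>

lemma agree_if_both_nearer:
  fixes P :: "'a::euclidean_space set"
  assumes P: "polytope P" and x: "circumscribes P G x" and x': "circumscribes P G x'"
    and F: "F \<in> dim_faces 2 P"
    and e: "e \<in> dim_faces 1 P" "e' \<in> dim_faces 1 P" "e \<subseteq> F" "e' \<subseteq> F" "e \<noteq> e'"
    and v: "v extreme_point_of P" "v \<in> e" "v \<in> e'"
    and pos: "x e = v + p *\<^sub>R d" "x' e = v + q *\<^sub>R d" "0 < q" "q \<le> p"
      "x e' = v + p' *\<^sub>R d'" "x' e' = v + q' *\<^sub>R d'" "0 < q'" "q' \<le> p'"
    and f: "f \<in> dim_faces 1 P"
  shows "x' f = x f"
proof -
  have "x' e \<in> closed_segment v (x e)" "x' e' \<in> closed_segment v (x e')"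
    unfolding pos using pos by (simp_all add: nearer_on_ray)
  then have "x' e = x e" using corner_rigid[OF P x x' F e v] by blast
  then show ?thesis using agree_everywhere[OF P x x' e(1) _ f] by blast
qed

text \<open>The positions on the three edges of a triangular facet determine \<open>x\<close> by \<open>agree_everywhere\<close>. The corner
principle at the three vertices says that two solutions either agree or have all three parameters moved in the same sense
of rotation, which is the linear order required by \<open>card_fitting_triples_le_4\<close>.\<close>

lemma card_circumscribing_le_4_of_triangle:
  fixes P :: "'a::euclidean_space set"
  assumes P: "polytope P" and F: "F \<in> dim_faces 2 P" and three: "card {v. v extreme_point_of F} = 3"
  obtains c :: "('a set \<Rightarrow> 'a) \<Rightarrow> triple" where
    "finite (c ` {x. circumscribes P G x})" "card (c ` {x. circumscribes P G x}) \<le> 4"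
    "\<And>x x' f. \<lbrakk>circumscribes P G x; circumscribes P G x'; c x = c x'; f \<in> dim_faces 1 P\<rbrakk> \<Longrightarrow> x' f = x f"
proof -
  have FP: "F face_of P" "aff_dim F = 2" using F by (auto simp: dim_faces_def)
  have pF: "polytope F" using FP P face_of_polytope_polytope by blast
  obtain v where v: "v extreme_point_of F" using three by (metis card.empty empty_Collect_eq zero_neq_numeral)
  obtain e e' where e2: "{e \<in> dim_faces 1 F. v \<in> e} = {e, e'}" "e \<noteq> e'"
    using card_edges_at_polygon_vertex[OF pF FP(2) v] by (metis card_2_iff)
  then have e: "e \<in> dim_faces 1 F" "e' \<in> dim_faces 1 F" "v \<in> e" "v \<in> e'" by blast+
  obtain a b A B where ab: "e = closed_segment v a" "e' = closed_segment v b" "corner_frame F v a b A B"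
    using corner_coordinates[OF pF FP(2) e(1,2) e2(2) v e(3,4)] .
  then have a: "a extreme_point_of F" and b: "b extreme_point_of F"
    and AB: "A \<bullet> (a - v) = 1" "A \<bullet> (b - v) = 0" "B \<bullet> (a - v) = 0" "B \<bullet> (b - v) = 1"
    unfolding corner_frame_def by blast+
  have ne: "v \<noteq> a" "v \<noteq> b" "a \<noteq> b" using AB by auto
  have vertF: "{v. v extreme_point_of F} = {v, a, b}"
    using v a b ne three finite_extreme_points[OF pF]
    by (intro card_subset_eq[symmetric]) auto
  have vP: "v extreme_point_of P" "a extreme_point_of P" "b extreme_point_of P"
    using v a b extreme_point_of_face[OF FP(1)] by blast+
  define E1 E2 E3 where "E1 = closed_segment v a" and "E2 = closed_segment a b" and "E3 = closed_segment b v"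
  note E_def = E1_def E2_def E3_def
  have E: "E1 \<in> dim_faces 1 F" "E2 \<in> dim_faces 1 F" "E3 \<in> dim_faces 1 F"
    unfolding E_def using triangle_sides[OF pF FP(2) three] v a b ne by simp_all
  have neE: "E1 \<noteq> E2" "E2 \<noteq> E3" "E3 \<noteq> E1"
    unfolding E_def using ne by (auto simp: doubleton_eq_iff)
  have edgesF: "dim_faces 1 F = {E1, E2, E3}"
    using E neE card_polygon_edges[OF pF FP(2)] three finite_dim_faces[OF pF, of 1]
    by (intro card_subset_eq[symmetric]) auto
  then have edges: "{e \<in> dim_faces 1 P. e \<subseteq> F} = {E1, E2, E3}"
    using dim_faces_of_face[OF FP(1)] by simp
  have EP: "E1 \<in> dim_faces 1 P" "E2 \<in> dim_faces 1 P" "E3 \<in> dim_faces 1 P" "E1 \<subseteq> F" "E2 \<subseteq> F" "E3 \<subseteq> F"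
    using edges by blast+
  have vE: "v \<in> E1" "v \<in> E3" "a \<in> E1" "a \<in> E2" "b \<in> E2" "b \<in> E3" by (simp_all add: E_def)
  define T S M where "T x = A \<bullet> (x E1 - v)" and "S x = B \<bullet> (x E2 - v)" and "M x = 1 - B \<bullet> (x E3 - v)"
    for x :: "'a set \<Rightarrow> 'a"
  define c where "c x = (T x, S x, M x)" for x
  have pts: "0 < T x" "T x < 1" "x E1 = v + T x *\<^sub>R (a - v)" "0 < S x" "S x < 1" "x E2 = a + S x *\<^sub>R (b - a)"
    "0 < M x" "M x < 1" "x E3 = b + M x *\<^sub>R (v - b)" if x: "circumscribes P G x" for x
  proof -
    obtain t where t: "0 < t" "t < 1" "x E1 = v + t *\<^sub>R (a - v)"
      using inner_point_on_edge[OF x] EP(1) unfolding E1_def by blast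
    obtain s where s: "0 < s" "s < 1" "x E2 = a + s *\<^sub>R (b - a)"
      using inner_point_on_edge[OF x] EP(2) unfolding E2_def by blast
    obtain m where m: "0 < m" "m < 1" "x E3 = b + m *\<^sub>R (v - b)"
      using inner_point_on_edge[OF x] EP(3) unfolding E3_def by blast
    have "T x = t" unfolding T_def t(3) using AB by simp
    moreover have "x E2 - v = (a - v) + s *\<^sub>R ((b - v) - (a - v))" unfolding s(3) by simp
    then have "S x = s" unfolding S_def using AB by (simp add: inner_add_right inner_diff_right)
    moreover have "x E3 - v = (1 - m) *\<^sub>R (b - v)" unfolding m(3) by (simp add: algebra_simps)
    then have "M x = m" unfolding M_def using AB by simp
    ultimately show "0 < T x" "T x < 1" "x E1 = v + T x *\<^sub>R (a - v)" "0 < S x" "S x < 1"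
      "x E2 = a + S x *\<^sub>R (b - a)" "0 < M x" "M x < 1" "x E3 = b + M x *\<^sub>R (v - b)"
      using t s m by simp_all
  qed
  have pts': "x E1 = a + (1 - T x) *\<^sub>R (v - a)" "x E2 = b + (1 - S x) *\<^sub>R (a - b)"
    "x E3 = v + (1 - M x) *\<^sub>R (b - v)" if x: "circumscribes P G x" for x
    unfolding pts(3,6,9)[OF x] by (simp_all add: algebra_simps)
  have agree: "x' f = x f"
    if x: "circumscribes P G x" and x': "circumscribes P G x'" and f: "f \<in> dim_faces 1 P"
    and le: "T x \<le> T x' \<and> S x' \<le> S x \<or> S x \<le> S x' \<and> M x' \<le> M x \<or> M x \<le> M x' \<and> T x' \<le> T x" for x x' f
  proof -
    have pos: "0 < 1 - T x'" "0 < 1 - S x'" "0 < 1 - M x'" using pts[OF x'] by simp_all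
    from le show ?thesis
    proof (elim disjE conjE)
      assume "T x \<le> T x'" "S x' \<le> S x"
      then show ?thesis
        using agree_if_both_nearer[OF P x x' F EP(1,2,4,5) neE(1) vP(2) vE(3,4) pts'(1)[OF x] pts'(1)[OF x']
            pos(1) _ pts(6)[OF x] pts(6)[OF x'] pts(4)[OF x'] _ f] by simp
    next
      assume "S x \<le> S x'" "M x' \<le> M x"
      then show ?thesis
        using agree_if_both_nearer[OF P x x' F EP(2,3,5,6) neE(2) vP(3) vE(5,6) pts'(2)[OF x] pts'(2)[OF x']
            pos(2) _ pts(9)[OF x] pts(9)[OF x'] pts(7)[OF x'] _ f] by simp
    next
      assume "M x \<le> M x'" "T x' \<le> T x"
      then show ?thesis
        using agree_if_both_nearer[OF P x x' F EP(3,1,6,4) neE(3) vP(1) vE(2,1) pts'(3)[OF x] pts'(3)[OF x']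
            pos(3) _ pts(3)[OF x] pts(3)[OF x'] pts(1)[OF x'] _ f] by simp
    qed
  qed
  have c_eq: "c x = c x'" if "\<And>f. f \<in> dim_faces 1 P \<Longrightarrow> x' f = x f" for x x'
    using that EP by (simp add: c_def T_def S_def M_def)
  let ?X = "{x. circumscribes P G x}"
  \<comment> \<open>barycentric coordinates with respect to v, a, b\<close>
  define k where "k z = (1 - A \<bullet> (z - v) - B \<bullet> (z - v), A \<bullet> (z - v), B \<bullet> (z - v))" for z
  have lin: "C \<bullet> ((1 - l) *\<^sub>R p + l *\<^sub>R q - v) = (1 - l) * (C \<bullet> (p - v)) + l * (C \<bullet> (q - v))" for C p q l
    by (simp add: algebra_simps)
  have fit: "\<exists>g1 g2 g3. fits (c x) g1 g2 g3 \<and> k ` (G \<inter> F) = {g1, g2, g3}" if x: "circumscribes P G x" for x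
  proof -
    let ?p = "x E1" and ?q = "x E2" and ?r = "x E3"
    have Ap: "A \<bullet> (?p - v) = T x" "B \<bullet> (?p - v) = 0"
      using pts[OF x] AB by simp_all
    have q: "?q - v = (a - v) + S x *\<^sub>R ((b - v) - (a - v))" using pts(6)[OF x] by simp
    have Aq: "A \<bullet> (?q - v) = 1 - S x" "B \<bullet> (?q - v) = S x"
      unfolding q inner_add_right inner_scaleR_right inner_diff_right[of _ "b - v" "a - v"] AB by simp_all
    have "?r - v = (1 - M x) *\<^sub>R (b - v)" using pts'(3)[OF x] by simp
    then have Ar: "A \<bullet> (?r - v) = 0" "B \<bullet> (?r - v) = 1 - M x" using AB by simp_all
    have neq: "?p \<noteq> ?q" "?q \<noteq> ?r" "?r \<noteq> ?p" using inner_points_distinct[OF x] EP neE by blast+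
    obtain y where y: "\<forall>s\<in>joined_points (skeleton P) F x. y s \<in> rel_interior s"
      "G \<inter> F = y ` joined_points (skeleton P) F x"
      using inscribed_points_on_face[OF x F] .
    have J: "joined_points (skeleton P) F x = {closed_segment ?p ?q, closed_segment ?q ?r, closed_segment ?r ?p}"
    proof
      show "joined_points (skeleton P) F x \<subseteq> {closed_segment ?p ?q, closed_segment ?q ?r, closed_segment ?r ?p}"
      proof
        fix s assume "s \<in> joined_points (skeleton P) F x"
        then obtain e e' where s: "s = closed_segment (x e) (x e')" and "e \<noteq> e'"
          and "e \<in> {e \<in> dim_faces 1 P. e \<subseteq> F}" "e' \<in> {e \<in> dim_faces 1 P. e \<subseteq> F}"
          unfolding joined_points_eq by blast
        then have "e \<noteq> e'" "e = E1 \<or> e = E2 \<or> e = E3" "e' = E1 \<or> e' = E2 \<or> e' = E3"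
          unfolding edges by blast+
        then show "s \<in> {closed_segment ?p ?q, closed_segment ?q ?r, closed_segment ?r ?p}"
          unfolding s by (elim disjE) (simp_all add: closed_segment_commute)
      qed
      have "E1 \<inter> E2 \<noteq> {}" "E2 \<inter> E3 \<noteq> {}" "E3 \<inter> E1 \<noteq> {}" using vE by blast+
      then show "{closed_segment ?p ?q, closed_segment ?q ?r, closed_segment ?r ?p} \<subseteq> joined_points (skeleton P) F x"
        unfolding joined_points_eq using EP neE by blast
    qed
    define g1 g2 g3 where "g1 = y (closed_segment ?p ?q)" and "g2 = y (closed_segment ?q ?r)"
      and "g3 = y (closed_segment ?r ?p)"
    have "g1 \<in> open_segment ?p ?q" "g2 \<in> open_segment ?q ?r" "g3 \<in> open_segment ?r ?p"
      using y(1) neq unfolding J g1_def g2_def g3_def by (simp_all add: rel_interior_closed_segment)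
    then obtain l1 l2 l3 where l: "0 < l1" "l1 < 1" "g1 = (1 - l1) *\<^sub>R ?p + l1 *\<^sub>R ?q"
      "0 < l2" "l2 < 1" "g2 = (1 - l2) *\<^sub>R ?q + l2 *\<^sub>R ?r"
      "0 < l3" "l3 < 1" "g3 = (1 - l3) *\<^sub>R ?r + l3 *\<^sub>R ?p"
      unfolding in_segment by blast
    have "on_side (c x) (k g1)"
      unfolding on_side_def c_def k_def l(3) lin Ap Aq using l(1,2)
      by (auto intro!: exI[of _ l1] simp: algebra_simps)
    moreover have "on_side (rot (c x)) (rot (k g2))"
      unfolding on_side_def c_def k_def l(6) lin Aq Ar using l(4,5)
      by (auto intro!: exI[of _ l2] simp: algebra_simps)
    moreover have "on_side (rot (rot (c x))) (rot (rot (k g3)))"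
      unfolding on_side_def c_def k_def l(9) lin Ar Ap using l(7,8)
      by (auto intro!: exI[of _ l3] simp: algebra_simps)
    ultimately have "fits (c x) (k g1) (k g2) (k g3)" by (simp add: fits_def)
    moreover have "k ` (G \<inter> F) = {k g1, k g2, k g3}"
      unfolding y(2) J by (simp add: g1_def g2_def g3_def)
    ultimately show ?thesis by blast
  qed
  have "finite (c ` ?X) \<and> card (c ` ?X) \<le> 4"
  proof (rule card_fitting_triples_le_4)
    show "in_cube z" if "z \<in> c ` ?X" for z
      using that pts by (auto simp: in_cube_def c_def)
    show "\<exists>g1 g2 g3. fits z g1 g2 g3 \<and> k ` (G \<inter> F) = {g1, g2, g3}" if "z \<in> c ` ?X" for z
      using that fit by blast
    fix z z' assume "z \<in> c ` ?X" "z' \<in> c ` ?X"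
    then obtain x x' where x: "circumscribes P G x" "circumscribes P G x'" "z = c x" "z' = c x'" by blast
    have "z = z'" if "T x \<le> T x' \<and> S x' \<le> S x \<or> S x \<le> S x' \<and> M x' \<le> M x \<or> M x \<le> M x' \<and> T x' \<le> T x"
      unfolding x(3,4) by (rule c_eq) (rule agree[OF x(1,2) _ that])
    moreover have "z' = z" if "T x' \<le> T x \<and> S x \<le> S x' \<or> S x' \<le> S x \<and> M x \<le> M x' \<or> M x' \<le> M x \<and> T x \<le> T x'"
      unfolding x(3,4) by (rule c_eq) (rule agree[OF x(2,1) _ that])
    ultimately show "z = z' \<or> less3 z z' \<or> less3 z' z"
      unfolding x(3,4) c_def less3_def prod.case by (smt (verit))
  qed
  moreover have "x' f = x f" if "circumscribes P G x" "circumscribes P G x'" "c x = c x'" "f \<in> dim_faces 1 P" for x x' f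
    using agree[OF that(1,2,4)] that(3) by (simp add: c_def)
  ultimately show thesis using that by blast
qed

text \<open>The code \<open>c\<close> identifies the restriction of \<open>x\<close> to the edges of \<open>P\<close>. In the case of a
vertex of degree three a constant code suffices.\<close>

lemma card_circumscribing_le_4:
  fixes P :: "'a::euclidean_space set"
  assumes P: "polytope P" "aff_dim P = 3"
  obtains c :: "('a set \<Rightarrow> 'a) \<Rightarrow> triple" where
    "finite (c ` {x. circumscribes P G x})" "card (c ` {x. circumscribes P G x}) \<le> 4"
    "\<And>x x' f. \<lbrakk>circumscribes P G x; circumscribes P G x'; c x = c x'; f \<in> dim_faces 1 P\<rbrakk> \<Longrightarrow> x' f = x f"
  using trivalent_vertex_or_triangle[OF P]
proof cases
  case (1 v)
  define c :: "('a set \<Rightarrow> 'a) \<Rightarrow> triple" where "c = (\<lambda>_. (0, 0, 0))"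
  have sub: "c ` {x. circumscribes P G x} \<subseteq> {(0, 0, 0)}" by (auto simp: c_def)
  show thesis
  proof (rule that[of c])
    show "finite (c ` {x. circumscribes P G x})" using sub finite_subset by blast
    show "card (c ` {x. circumscribes P G x}) \<le> 4" using card_mono[OF _ sub] by simp
  qed (use agree_if_trivalent_vertex[OF P _ _ 1] in blast)
next
  case (2 F)
  show thesis by (rule card_circumscribing_le_4_of_triangle[OF P(1) 2]) (rule that)
qed

text \<open>The graph is determined by \<open>x\<close>, so counting graphs reduces to counting the possible \<open>x\<close>.\<close>

lemma circumscribed_graph:
  assumes P: "aff_dim P = 3"
    and "inscribed_into (polyhedron_faces P) \<beta> (skeleton P)" "inscribed_on_faces (polyhedron_faces P) \<gamma> \<beta>"
  obtains x where "circumscribes P (vertices \<gamma>) x"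
    "\<beta> = \<lparr> vertices = x ` dim_faces 1 P, edges = \<Union>F\<in>dim_faces 2 P. joined_points (skeleton P) F x \<rparr>"
proof -
  have faces: "polyhedron_faces P = dim_faces 2 P"
    unfolding polyhedron_faces_def dim_faces_def facet_of_def using P by auto
  obtain x where x: "chooses_inner_points (skeleton P) x" "vertices \<beta> = x ` dim_faces 1 P"
    "edges \<beta> = (\<Union>F\<in>dim_faces 2 P. joined_points (skeleton P) F x)"
    using assms(2) unfolding inscribed_into_def faces edges_skeleton by blast
  obtain y where y: "chooses_inner_points \<beta> y" "vertices \<gamma> = y ` edges \<beta>"
    using assms(3) unfolding inscribed_on_faces_def by blast
  have "circumscribes P (vertices \<gamma>) x"
    unfolding circumscribes_def
  proof (intro conjI exI[of _ y])
    show "\<forall>e\<in>dim_faces 1 P. x e \<in> rel_interior e"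
      using x(1) by (simp add: chooses_inner_points_def edges_skeleton)
    show "\<forall>s\<in>(\<Union>F\<in>dim_faces 2 P. joined_points (skeleton P) F x). y s \<in> rel_interior s"
      using y(1) x(3) by (simp add: chooses_inner_points_def)
    show "vertices \<gamma> = y ` (\<Union>F\<in>dim_faces 2 P. joined_points (skeleton P) F x)"
      using y(2) x(3) by simp
  qed
  moreover have "\<beta> = \<lparr> vertices = x ` dim_faces 1 P, edges = \<Union>F\<in>dim_faces 2 P. joined_points (skeleton P) F x \<rparr>"
    using x(2,3) by simp
  ultimately show thesis by (rule that)
qed

theorem theorem3p1:
  fixes P :: "(real^3) set" and \<alpha> \<gamma> :: "(real^3) geom_graph"
  assumes "polytope P" and "aff_dim P = 3"
    and "\<alpha> = skeleton P"
    and "is_graph \<gamma>"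
  defines "\<B> \<equiv> {\<beta> :: (real^3) geom_graph.
      inscribed_into (polyhedron_faces P) \<beta> \<alpha> \<and>
      inscribed_on_faces (polyhedron_faces P) \<gamma> \<beta>}"
  shows "finite \<B> \<and> card \<B> \<le> 4"
proof -
  let ?X = "{x. circumscribes P (vertices \<gamma>) x}"
  define graph where "graph x = \<lparr> vertices = x ` dim_faces 1 P,
    edges = \<Union>F\<in>dim_faces 2 P. joined_points (skeleton P) F x \<rparr>" for x :: "(real^3) set \<Rightarrow> real^3"
  obtain c :: "((real^3) set \<Rightarrow> real^3) \<Rightarrow> triple" where c: "finite (c ` ?X)" "card (c ` ?X) \<le> 4"
    and agree: "\<And>x x' f. \<lbrakk>circumscribes P (vertices \<gamma>) x; circumscribes P (vertices \<gamma>) x'; c x = c x';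
      f \<in> dim_faces 1 P\<rbrakk> \<Longrightarrow> x' f = x f"
    by (rule card_circumscribing_le_4[OF assms(1,2)]) blast
  have graph_eq: "graph x' = graph x" if "x \<in> ?X" "x' \<in> ?X" "c x = c x'" for x x'
  proof -
    have xx: "x' f = x f" if "f \<in> dim_faces 1 P" for f
      using agree \<open>x \<in> ?X\<close> \<open>x' \<in> ?X\<close> \<open>c x = c x'\<close> that by blast
    have "joined_points (skeleton P) F z \<subseteq> joined_points (skeleton P) F z'"
      if z: "\<And>f. f \<in> dim_faces 1 P \<Longrightarrow> z f = z' f" for F and z z' :: "(real^3) set \<Rightarrow> real^3"
    proof
      fix s assume "s \<in> joined_points (skeleton P) F z"
      then obtain e e' where e: "e \<in> dim_faces 1 P" "e \<subseteq> F" "e' \<in> dim_faces 1 P" "e' \<subseteq> F" "e \<noteq> e'"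
        "e \<inter> e' \<noteq> {}" "s = closed_segment (z e) (z e')"
        unfolding joined_points_eq by blast
      then have "s = closed_segment (z' e) (z' e')" using z by simp
      with e show "s \<in> joined_points (skeleton P) F z'" unfolding joined_points_eq by blast
    qed
    then have "joined_points (skeleton P) F x' = joined_points (skeleton P) F x" for F
      using xx by (intro subset_antisym) simp_all
    moreover have "x' ` dim_faces 1 P = x ` dim_faces 1 P" using xx by (rule image_cong[OF refl])
    ultimately show ?thesis by (simp add: graph_def)
  qed
  define h where "h z = graph (SOME x. x \<in> ?X \<and> c x = z)" for z
  have "\<B> \<subseteq> h ` c ` ?X"
  proof
    fix \<beta> assume "\<beta> \<in> \<B>"
    then obtain x where x: "x \<in> ?X" "\<beta> = graph x"
      using circumscribed_graph[OF assms(2)] unfolding \<B>_def assms(3) graph_def by blast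
    define x' where "x' = (SOME x'. x' \<in> ?X \<and> c x' = c x)"
    have "x' \<in> ?X \<and> c x' = c x"
      unfolding x'_def by (rule someI[of _ x]) (use x(1) in simp)
    then have "graph x' = graph x" using graph_eq[OF x(1), of x'] by simp
    then have "h (c x) = \<beta>" using x(2) by (simp add: h_def x'_def)
    then show "\<beta> \<in> h ` c ` ?X" using x(1) by blast
  qed
  then show ?thesis
    using c finite_subset[of \<B> "h ` c ` ?X"] card_mono[of "h ` c ` ?X" \<B>] card_image_le[OF c(1), of h]
    by auto
qed

end
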